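(* For any $f\in\mathbf{B}_{k,n}$, any $P\in\mathcal{P}_{k,n}$ and any reduced word $\mathbf f$ for $f$, there is a bijection $$\phi_{\mathbf f}:\widetilde{\operatorname{Deo}}_{f,P}\to\operatorname{Deo}_{f,P}$$ from the set of anti-distinguished $(f,P)$-affine Deograms to the set of (distinguished) $(f,P)$-affine Deograms.
   Context: Let $n\ge 1$, $0\le k\le n$. An $n$-periodic affine permutation is a bijection $f:\mathbb{Z}\to\mathbb{Z}$ with $f(i+n)=f(i)+n$ for all $i$. $\mathbf{B}_{k,n}$ is the set of those with $\frac1n\sum_{i=1}^n(f(i)-i)=k$ and $i\le f(i)\le i+n$ for all $i$. A reduced word for $f$ is a reduced word in the simple transpositions $s_0,\dots,s_{n-1}$ for the element of the affine Weyl group of type $\tilde A_{n-1}$ (affine permutations with $\sum_{i=1}^n(f(i)-i)=0$) obtained from $f$ by composing with the shift $i\mapsto i-k$. Lattice paths: $\mathcal{P}_{k,n}$ is the set of lattice paths $P$ from $(0,0)$ to $(n-k,k)$ with unit steps $P_1,\dots,P_n\in\{\mathrm R,\mathrm U\}$ (right, up). Extend $P$ to a bi-infinite path with steps indexed by $\mathbb{Z}$ via $P_{i+n}=P_i$ (step $1$ starts at $(0,0)$); it is invariant under translation by $(n-k,k)$. The strip of $P$ is the region between the extended path $P$ (southern boundary) and its translate $P+(0,k)$ (northern boundary). On each boundary the unit edges are labeled by $\mathbb{Z}$: the southern edge labeled $i$ is step $i$ of $P$, and the northern edge labeled $i$ is its translate by $(0,k)$. Fillings: a periodic filling assigns to each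 unit box of the strip a crossing or an elbow, invariantly under translation by $(n-k,k)$. Strands enter at the northern boundary edges and travel right/down: in a crossing box a strand entering from the left exits right and one entering from the top exits at the bottom; in an elbow box a strand entering from the left exits at the bottom and one entering from the top exits right. Each strand ends at a southern boundary edge; the strand permutation sends $i$ to $j$ if the strand entering at northern edge $i$ exits at southern edge $j$. (If $k\in\{0,n\}$ the strip has no boxes and each strand exits at the edge where it enters.) $\operatorname{Deo}_{f,P}$ is the set of periodic fillings with strand permutation $f$ that are distinguished: whenever two strands form an elbow in a box, they have crossed each other an even number of times in boxes traversed before it (counting from the northern boundary). $\widetilde{\operatorname{Deo}}_{f,P}$ is the set of periodic fillings with strand permutation $f$ that are anti-distinguished: whenever two strands form an elbow in a box, they cross each other an even number of times in boxes traversed after it (i.e. the same condition counted from the southern boundary). *)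

theory Defs
  imports Main
begin

section \<open>Bounded affine permutations and reduced words\<close>

definition affine_permutation :: "nat \<Rightarrow> (int \<Rightarrow> int) \<Rightarrow> bool" where
  "affine_permutation n f \<longleftrightarrow> bij f \<and> (\<forall>i. f (i + int n) = f i + int n)"

text \<open>The condition that the average of \<open>f i - i\<close> over a period is \<open>k\<close> is multiplied by \<open>n\<close>.\<close>

definition bounded_affine_perms :: "nat \<Rightarrow> nat \<Rightarrow> (int \<Rightarrow> int) set" where
  "bounded_affine_perms k n =
     {f. affine_permutation n f \<and> (\<Sum>i = 1..int n. f i - i) = int k * int n \<and>
         (\<forall>i. i \<le> f i \<and> f i \<le> i + int n)}"

text \<open>
  For \<open>n = 1\<close> the affine Weyl group is trivial and \<open>s_0\<close> has no meaning; the value given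
  to it here is immaterial, since the identity has the empty word as its only reduced word.
\<close>

definition simple_transposition :: "nat \<Rightarrow> nat \<Rightarrow> int \<Rightarrow> int" where
  "simple_transposition n i m =
     (if m mod int n = int i mod int n then m + 1
      else if m mod int n = (int i + 1) mod int n then m - 1
      else m)"

definition word_product :: "nat \<Rightarrow> nat list \<Rightarrow> int \<Rightarrow> int" where
  "word_product n w = foldr (\<circ>) (map (simple_transposition n) w) id"

definition reduced_word :: "nat \<Rightarrow> (int \<Rightarrow> int) \<Rightarrow> nat list \<Rightarrow> bool" where
  "reduced_word n g w \<longleftrightarrow>
     set w \<subseteq> {..<n} \<and> word_product n w = g \<and>
     (\<forall>v. set v \<subseteq> {..<n} \<and> word_product n v = g \<longrightarrow> length w \<le> length v)"

definition reduced_word_for :: "nat \<Rightarrow> nat \<Rightarrow> (int \<Rightarrow> int) \<Rightarrow> nat list \<Rightarrow> bool" where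
  "reduced_word_for k n f w \<longleftrightarrow> reduced_word n ((\<lambda>i. i - int k) \<circ> f) w"


section \<open>Lattice paths and strips\<close>

datatype step = Right | Up

definition width :: "step list \<Rightarrow> int" where
  "width P = int (count_list P Right)"

definition height :: "step list \<Rightarrow> int" where
  "height P = int (count_list P Up)"

definition lattice_paths :: "nat \<Rightarrow> nat \<Rightarrow> step list set" where
  "lattice_paths k n = {P. length P = n \<and> width P = int n - int k \<and> height P = int k}"

text \<open>
  In the bi-infinite extension of \<open>P\<close>, step \<open>i\<close> runs from vertex \<open>i - 1\<close> to vertex \<open>i\<close>,
  and vertex \<open>0\<close> is the origin.
\<close>

definition ext_step :: "step list \<Rightarrow> int \<Rightarrow> step" where
  "ext_step P i = P ! nat ((i - 1) mod int (length P))"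

definition ext_vertex :: "step list \<Rightarrow> int \<Rightarrow> int \<times> int" where
  "ext_vertex P i =
     (let q = i div int (length P); Q = take (nat (i mod int (length P))) P
      in (q * width P + width Q, q * height P + height Q))"

text \<open>
  \<open>Hor x y\<close> is the edge from \<open>(x, y)\<close> to \<open>(x + 1, y)\<close>, and \<open>Ver x y\<close> is the edge from
  \<open>(x, y)\<close> to \<open>(x, y + 1)\<close>. A unit box is represented by its lower left corner.
\<close>

datatype edge = Hor int int | Ver int int

type_synonym box = "int \<times> int"

definition edge_of_step :: "step \<Rightarrow> int \<times> int \<Rightarrow> edge" where
  "edge_of_step s v = (case s of Right \<Rightarrow> Hor (fst v) (snd v) | Up \<Rightarrow> Ver (fst v) (snd v))"

definition south_edge :: "step list \<Rightarrow> int \<Rightarrow> edge" where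
  "south_edge P i = edge_of_step (ext_step P i) (ext_vertex P (i - 1))"

definition north_edge :: "step list \<Rightarrow> int \<Rightarrow> edge" where
  "north_edge P i =
     edge_of_step (ext_step P i)
       (fst (ext_vertex P (i - 1)), snd (ext_vertex P (i - 1)) + height P)"

text \<open>
  If the horizontal step of the extended path in the column of a box is at height \<open>y\<close>, then
  the northern boundary crosses this column at height \<open>y + height P\<close>.
\<close>

definition strip :: "step list \<Rightarrow> box set" where
  "strip P = {(a, b). \<exists>i y. south_edge P i = Hor a y \<and> y \<le> b \<and> b < y + height P}"


section \<open>Periodic fillings and strands\<close>

datatype tile = Crossing | Elbow

type_synonym filling = "box \<Rightarrow> tile option"

definition periodic_filling :: "step list \<Rightarrow> filling \<Rightarrow> bool" where
  "periodic_filling P D \<longleftrightarrow>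
     dom D = strip P \<and> (\<forall>a b. D (a + width P, b + height P) = D (a, b))"

text \<open>
  A strand is followed through the edges it meets. Going right or down, it enters from a
  vertical edge the box to its right, and from a horizontal edge the box below.
\<close>

fun entered_box :: "edge \<Rightarrow> box" where
  "entered_box (Hor a b) = (a, b - 1)"
| "entered_box (Ver a b) = (a, b)"

fun exit_edge :: "tile \<Rightarrow> edge \<Rightarrow> edge" where
  "exit_edge Crossing (Hor a b) = Hor a (b - 1)"
| "exit_edge Crossing (Ver a b) = Ver (a + 1) b"
| "exit_edge Elbow (Hor a b) = Ver (a + 1) (b - 1)"
| "exit_edge Elbow (Ver a b) = Hor a b"

definition advance :: "filling \<Rightarrow> edge \<Rightarrow> edge \<Rightarrow> bool" where
  "advance D e e' \<longleftrightarrow> (\<exists>t. D (entered_box e) = Some t \<and> e' = exit_edge t e)"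

text \<open>Strand \<open>i\<close> is the strand that enters the strip at northern edge \<open>i\<close>.\<close>

definition on_strand :: "step list \<Rightarrow> filling \<Rightarrow> int \<Rightarrow> edge \<Rightarrow> bool" where
  "on_strand P D i e \<longleftrightarrow> (advance D)\<^sup>*\<^sup>* (north_edge P i) e"

text \<open>
  The box entered from a southern edge lies outside the strip, so a strand stops as soon as it
  meets a southern edge. If the strip has no boxes, each northern edge is itself a southern edge.
\<close>

definition has_strand_permutation :: "step list \<Rightarrow> filling \<Rightarrow> (int \<Rightarrow> int) \<Rightarrow> bool" where
  "has_strand_permutation P D f \<longleftrightarrow> (\<forall>i. on_strand P D i (south_edge P (f i)))"

definition traverses :: "step list \<Rightarrow> filling \<Rightarrow> int \<Rightarrow> box \<Rightarrow> bool" where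
  "traverses P D i B \<longleftrightarrow> B \<in> dom D \<and> (\<exists>e. on_strand P D i e \<and> entered_box e = B)"

text \<open>\<open>traverses_before P D i B C\<close>: strand \<open>i\<close> traverses \<open>B\<close> and, strictly later, \<open>C\<close>.\<close>

definition traverses_before :: "step list \<Rightarrow> filling \<Rightarrow> int \<Rightarrow> box \<Rightarrow> box \<Rightarrow> bool" where
  "traverses_before P D i B C \<longleftrightarrow>
     B \<in> dom D \<and> C \<in> dom D \<and>
     (\<exists>e e'. on_strand P D i e \<and> (advance D)\<^sup>+\<^sup>+ e e' \<and> entered_box e = B \<and> entered_box e' = C)"


section \<open>Affine Deograms\<close>

text \<open>Two distinct strands traversing the same crossing box cross each other there.\<close>

definition crossings_before :: "step list \<Rightarrow> filling \<Rightarrow> int \<Rightarrow> int \<Rightarrow> box \<Rightarrow> box set" where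
  "crossings_before P D i j B =
     {C. D C = Some Crossing \<and> traverses_before P D i C B \<and> traverses_before P D j C B}"

definition crossings_after :: "step list \<Rightarrow> filling \<Rightarrow> int \<Rightarrow> int \<Rightarrow> box \<Rightarrow> box set" where
  "crossings_after P D i j B =
     {C. D C = Some Crossing \<and> traverses_before P D i B C \<and> traverses_before P D j B C}"

definition distinguished :: "step list \<Rightarrow> filling \<Rightarrow> bool" where
  "distinguished P D \<longleftrightarrow>
     (\<forall>B i j. D B = Some Elbow \<and> i \<noteq> j \<and> traverses P D i B \<and> traverses P D j B \<longrightarrow>
        even (card (crossings_before P D i j B)))"

definition anti_distinguished :: "step list \<Rightarrow> filling \<Rightarrow> bool" where
  "anti_distinguished P D \<longleftrightarrow>
     (\<forall>B i j. D B = Some Elbow \<and> i \<noteq> j \<and> traverses P D i B \<and> traverses P D j B \<longrightarrow>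
        even (card (crossings_after P D i j B)))"

definition Deo :: "(int \<Rightarrow> int) \<Rightarrow> step list \<Rightarrow> filling set" where
  "Deo f P = {D. periodic_filling P D \<and> has_strand_permutation P D f \<and> distinguished P D}"

definition anti_Deo :: "(int \<Rightarrow> int) \<Rightarrow> step list \<Rightarrow> filling set" where
  "anti_Deo f P =
     {D. periodic_filling P D \<and> has_strand_permutation P D f \<and> anti_distinguished P D}"

end

theory Submission
  imports Defs
begin

text \<open>
  Sweep the strip from north to south, one box orbit at a time. Labelling edges by antidiagonals,
  a crossing acts on the positions of the strands as a simple transposition and an elbow as the
  identity, so a filling with strand permutation \<open>f\<close> is a subword of a fixed word with product
  \<open>f\<close>, up to a shift. The parity of the number of crossings of two strands is read off from
  their relative order, hence distinguished fillings are counted by a coefficient of a product of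
  right multiplications \<open>x \<mapsto> x s + [x s > x] x\<close> applied to the identity, and anti-distinguished
  ones by the same coefficient for left multiplications. Left and right multiplications commute,
  so the two finite sets have the same cardinality.
\<close>

section \<open>Affine permutations\<close>

text \<open>Anti-distinguishedness refers to crossings still to come. Since the exits are prescribed
  by \<open>f\<close>, it compares the order of two strands at an elbow with the order of their
  exits, so its guard depends only on the map from current positions to exits. Both kinds of filling
  can thus be read along the same word in the same direction: one state sends labels to positions
  and starts at the identity up to a shift, the other sends positions to exits and ends at the
  identity. On the identity a left factor is a right factor, and commutation carries it past the
  rest of the word onto the target; this is how the two recursions meet. The infinite strip needs a
  sweep order that is periodic, increases along strands and separates distinct orbits of boxes. All
  boxes of an orbit are swept at once; for n at least 2 their swaps are disjoint and form one affine
  simple transposition. Paths with only one kind of step bound no boxes and are treated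
  apart.\<close>

lemma affine_permutation_shift:
  assumes "affine_permutation n x"
  shows "x (i + j * int n) = x i + j * int n"
proof (induction j rule: int_induct[where k = 0])
  case (step1 j)
  have "x ((i + j * int n) + int n) = x (i + j * int n) + int n"
    using assms unfolding affine_permutation_def by blast
  then show ?case using step1 by (simp add: algebra_simps)
next
  case (step2 j)
  have "x ((i + (j - 1) * int n) + int n) = x (i + (j - 1) * int n) + int n"
    using assms unfolding affine_permutation_def by blast
  then show ?case using step2 by (simp add: algebra_simps)
qed simp

lemma affine_permutation_inv:
  assumes "affine_permutation n x"
  shows "affine_permutation n (inv x)"
proof -
  have x: "bij x" using assms by (simp add: affine_permutation_def)
  have "inv x (i + int n) = inv x i + int n" for i
  proof (rule inv_f_eq)
    show "inj x" using x by (rule bij_is_inj)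
    have "x (inv x i + int n) = x (inv x i) + int n"
      using assms by (simp add: affine_permutation_def)
    then show "x (inv x i + int n) = i + int n"
      using x by (simp add: bij_is_surj surj_f_inv_f)
  qed
  with x show ?thesis by (simp add: affine_permutation_def bij_imp_bij_inv)
qed

lemma affine_permutation_comp:
  "affine_permutation n x \<Longrightarrow> affine_permutation n y \<Longrightarrow> affine_permutation n (x \<circ> y)"
  by (auto simp: affine_permutation_def bij_comp)

lemma affine_permutation_inv_apply [simp]:
  "affine_permutation n x \<Longrightarrow> inv x (x i) = i" "affine_permutation n x \<Longrightarrow> x (inv x i) = i"
  by (simp_all add: affine_permutation_def bij_is_inj bij_is_surj surj_f_inv_f)

lemma affine_permutation_mod_eq_iff:
  assumes "affine_permutation n x"
  shows "x i mod int n = x j mod int n \<longleftrightarrow> i mod int n = j mod int n"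
proof -
  have *: "y i mod int n = y j mod int n"
    if y: "affine_permutation n y" and eq: "i mod int n = j mod int n" for y i j
  proof -
    obtain c where "i = j + c * int n"
      using eq by (metis mod_eqE mult.commute)
    then show ?thesis using affine_permutation_shift[OF y] by simp
  qed
  show ?thesis
    using *[OF assms, of i j] *[OF affine_permutation_inv[OF assms], of "x i" "x j"] assms by auto
qed

lemma less_mod_eq_iff:
  assumes "affine_permutation n x" "i mod int n = j mod int n"
  shows "x i < x (i + 1) \<longleftrightarrow> x j < x (j + 1)"
proof -
  obtain c where "i = j + c * int n"
    using assms(2) by (metis mod_eqE mult.commute)
  then show ?thesis
    using affine_permutation_shift[OF assms(1), of j c]
      affine_permutation_shift[OF assms(1), of "j + 1" c] by (simp add: algebra_simps)
qed

lemma mod_add_one_eq_iff: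
  "(a + 1) mod m = (b + 1) mod (m :: int) \<longleftrightarrow> a mod m = b mod m"
  by (metis add_diff_cancel_right' mod_add_cong mod_diff_cong)

lemma mod_Suc_neq:
  assumes "2 \<le> n" shows "(a + 1) mod int n \<noteq> a mod int n"
proof
  assume "(a + 1) mod int n = a mod int n"
  then have "int n dvd 1" by (simp add: mod_eq_dvd_iff)
  with assms show False by simp
qed

lemma simple_transposition_periodic:
  "simple_transposition n i (m + int n) = simple_transposition n i m + int n"
  by (simp add: simple_transposition_def)

lemma simple_transposition_simps:
  assumes "2 \<le> n" "p mod int n = int i mod int n"
  shows "simple_transposition n i p = p + 1" "simple_transposition n i (p + 1) = p"
  using assms mod_Suc_neq[OF assms(1), of "int i"] mod_add_one_eq_iff[of p "int n" "int i"]
  by (auto simp: simple_transposition_def)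

lemma simple_transposition_other:
  assumes "m mod int n \<noteq> int i mod int n" "m mod int n \<noteq> (int i + 1) mod int n"
  shows "simple_transposition n i m = m"
  using assms by (simp add: simple_transposition_def)

lemma simple_transposition_cases:
  assumes "2 \<le> n"
  obtains (lower) p where "m = p" "p mod int n = int i mod int n" "simple_transposition n i m = p + 1"
  | (upper) p where "m = p + 1" "p mod int n = int i mod int n" "simple_transposition n i m = p"
  | (other) "m mod int n \<noteq> int i mod int n" "m mod int n \<noteq> (int i + 1) mod int n"
      "simple_transposition n i m = m"
proof (cases "m mod int n = int i mod int n")
  case True
  then show ?thesis using that(1) simple_transposition_simps(1)[OF assms] by blast
next
  case False
  show ?thesis
  proof (cases "m mod int n = (int i + 1) mod int n")
    case True
    then have "(m - 1) mod int n = int i mod int n"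
      using mod_add_one_eq_iff[of "m - 1" "int n" "int i"] by simp
    then show ?thesis using that(2)[of "m - 1"] simple_transposition_simps(2)[OF assms] by fastforce
  next
    case False
    with \<open>m mod int n \<noteq> int i mod int n\<close> show ?thesis
      using that(3) simple_transposition_other by blast
  qed
qed

lemma simple_transposition_involution [simp]:
  assumes "2 \<le> n"
  shows "simple_transposition n i (simple_transposition n i m) = m"
  by (rule simple_transposition_cases[OF assms, of m i])
    (use simple_transposition_simps[OF assms] in auto)

lemma affine_permutation_simple_transposition:
  assumes "2 \<le> n"
  shows "affine_permutation n (simple_transposition n i)"
proof -
  have "bij (simple_transposition n i)"
    by (rule o_bij[where g = "simple_transposition n i"]) (use assms in auto)
  then show ?thesis
    using simple_transposition_periodic by (simp add: affine_permutation_def)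
qed

lemma inv_simple_transposition:
  "2 \<le> n \<Longrightarrow> inv (simple_transposition n i) = simple_transposition n i"
  by (rule inv_equality) auto

text \<open>Taken at \<open>x r\<close> and \<open>x (r + 1)\<close> this is the case in which left
  multiplication of \<open>x\<close> by s_i equals right multiplication by s_r. Taken at the
  positions of two strands it says that s_i makes them cross.\<close>

definition exchanged :: "nat \<Rightarrow> nat \<Rightarrow> int \<Rightarrow> int \<Rightarrow> bool" where
  "exchanged n i u v \<longleftrightarrow>
     (\<exists>p. p mod int n = int i mod int n \<and> (u = p \<and> v = p + 1 \<or> u = p + 1 \<and> v = p))"

text \<open>Every point moves by at most 1, so only close points could change order; at distance 2
  injectivity forbids meeting in the middle, and neighbours change order only if they are swapped
  with each other.\<close>

lemma simple_transposition_less_iff: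
  assumes "2 \<le> n" "u \<noteq> v"
  shows "simple_transposition n i u < simple_transposition n i v \<longleftrightarrow>
    (if exchanged n i u v then \<not> u < v else u < v)"
proof (cases "exchanged n i u v")
  case True
  then obtain p where "p mod int n = int i mod int n" "u = p \<and> v = p + 1 \<or> u = p + 1 \<and> v = p"
    unfolding exchanged_def by blast
  with True show ?thesis using simple_transposition_simps[OF assms(1), of p i] by auto
next
  case False
  define s where "s = simple_transposition n i"
  have "s u \<noteq> s v"
    using assms simple_transposition_involution[OF assms(1)] unfolding s_def by metis
  moreover define Q where "Q m \<longleftrightarrow> m mod int n = int i mod int n" for m
  have "v = u + 1 \<Longrightarrow> \<not> Q u" "u = v + 1 \<Longrightarrow> \<not> Q v"
    using False unfolding exchanged_def Q_def by blast+
  moreover have "s m = m \<or> s m = m + 1 \<and> Q m \<or> s m = m - 1 \<and> Q (m - 1)" for m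
    unfolding s_def Q_def by (rule simple_transposition_cases[OF assms(1), of m i]) auto
  from this[of u] this[of v] have "s u < s v \<longleftrightarrow> u < v"
    using calculation \<open>u \<noteq> v\<close> by (smt (verit))
  with False show ?thesis by (simp add: s_def)
qed

text \<open>Conjugating s_r by \<open>x\<close> gives the periodic swap of \<open>x r\<close> and
  \<open>x (r + 1)\<close>, which by assumption is s_q.\<close>

lemma exchanged_imp_commute:
  assumes n: "2 \<le> n" and x: "affine_permutation n x"
    and "exchanged n q (x (int r)) (x (int r + 1))"
  shows "simple_transposition n q \<circ> x = x \<circ> simple_transposition n r"
proof
  fix m
  let ?s = "simple_transposition n q" and ?t = "simple_transposition n r"
  let ?a = "x (int r)" and ?b = "x (int r + 1)"
  have sw: "?s ?a = ?b" "?s ?b = ?a"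
    using assms(3) simple_transposition_simps[OF n] unfolding exchanged_def by auto
  have res: "{?a mod int n, ?b mod int n} = {int q mod int n, (int q + 1) mod int n}"
    using assms(3) unfolding exchanged_def by (auto simp: mod_add_one_eq_iff)
  have s: "affine_permutation n ?s" using n by (rule affine_permutation_simple_transposition)
  have sh: "?s (x (c + j * int n)) = ?s (x c) + j * int n" for c j
    by (simp add: affine_permutation_shift[OF x] affine_permutation_shift[OF s])
  consider (lower) p where "m = p" "p mod int n = int r mod int n" "?t m = p + 1"
    | (upper) p where "m = p + 1" "p mod int n = int r mod int n" "?t m = p"
    | (other) "m mod int n \<noteq> int r mod int n" "m mod int n \<noteq> (int r + 1) mod int n" "?t m = m"
    by (rule simple_transposition_cases[OF n, of m r])
  then show "(?s \<circ> x) m = (x \<circ> ?t) m"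
  proof cases
    case (lower p)
    then obtain j where j: "p = int r + j * int n" by (metis mod_eqE mult.commute)
    have "?s (x m) = ?b + j * int n" using sh[of "int r" j] sw j lower by simp
    also have "\<dots> = x (p + 1)"
      using affine_permutation_shift[OF x, of "int r + 1" j] j by (simp add: algebra_simps)
    finally show ?thesis using lower by simp
  next
    case (upper p)
    then obtain j where j: "p = int r + j * int n" by (metis mod_eqE mult.commute)
    have "?s (x m) = ?a + j * int n"
      using sh[of "int r + 1" j] sw j upper by (simp add: algebra_simps)
    also have "\<dots> = x p" using affine_permutation_shift[OF x, of "int r" j] j by simp
    finally show ?thesis using upper by simp
  next
    case other
    then have "x m mod int n \<noteq> ?a mod int n" "x m mod int n \<noteq> ?b mod int n"
      by (simp_all add: affine_permutation_mod_eq_iff[OF x])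
    with res have "x m mod int n \<noteq> int q mod int n" "x m mod int n \<noteq> (int q + 1) mod int n"
      by (metis insertE insertI1 insertI2 singletonD)+
    then have "?s (x m) = x m" by (rule simple_transposition_other)
    then show ?thesis using other(3) by simp
  qed
qed

text \<open>Both sides express that \<open>x\<close> conjugates s_r to s_q. One implication, applied
  to \<open>x\<close> and to its inverse, therefore suffices.\<close>

lemma exchanged_inv_iff:
  assumes n: "2 \<le> n" and x: "affine_permutation n x"
  shows "exchanged n r (inv x (int q)) (inv x (int q + 1)) \<longleftrightarrow>
    exchanged n q (x (int r)) (x (int r + 1))"
proof -
  have *: "exchanged n q (y (int r)) (y (int r + 1))"
    if y: "affine_permutation n y" and ex: "exchanged n r (inv y (int q)) (inv y (int q + 1))"
    for y q r
  proof -
    obtain p where p: "p mod int n = int r mod int n"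
      "inv y (int q) = p \<and> inv y (int q + 1) = p + 1 \<or> inv y (int q) = p + 1 \<and> inv y (int q + 1) = p"
      using ex unfolding exchanged_def by blast
    obtain j where j: "p = int r + j * int n" using p(1) by (metis mod_eqE mult.commute)
    have "y p = y (int r) + j * int n" "y (p + 1) = y (int r + 1) + j * int n"
      using affine_permutation_shift[OF y, of "int r" j]
        affine_permutation_shift[OF y, of "int r + 1" j] j by (simp_all add: algebra_simps)
    moreover have "y p = int q \<and> y (p + 1) = int q + 1 \<or> y p = int q + 1 \<and> y (p + 1) = int q"
      using p(2) affine_permutation_inv_apply(2)[OF y] by metis
    ultimately have "y (int r) = int q - j * int n \<and> y (int r + 1) = int q - j * int n + 1 \<or>
      y (int r) = int q - j * int n + 1 \<and> y (int r + 1) = int q - j * int n"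
      by linarith
    moreover have "(int q - j * int n) mod int n = int q mod int n"
      by (simp add: mod_eq_dvd_iff)
    ultimately show ?thesis unfolding exchanged_def by blast
  qed
  have "inv (inv x) = x" using x by (simp add: affine_permutation_def inv_inv_eq)
  then show ?thesis using *[OF x] *[OF affine_permutation_inv[OF x]] by metis
qed

section \<open>Counting walks\<close>

text \<open>The state \<open>x\<close> sends strand labels to current positions; the guard says that
  the strands at positions q and q + 1 are in the order of their labels.\<close>

fun dist_count :: "nat \<Rightarrow> nat list \<Rightarrow> (int \<Rightarrow> int) \<Rightarrow> (int \<Rightarrow> int) \<Rightarrow> nat" where
  "dist_count n [] x g = of_bool (x = g)"
| "dist_count n (q # qs) x g =
     dist_count n qs (simple_transposition n q \<circ> x) g +
     of_bool (inv x (int q) < inv x (int q + 1)) * dist_count n qs x g"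

text \<open>The state \<open>y\<close> sends current positions to exits; the guard says that the
  strands at q and q + 1 exit in that order. Once all letters are read, every strand is at its exit,
  so \<open>y\<close> must be the identity.\<close>

fun anti_count :: "nat \<Rightarrow> nat list \<Rightarrow> (int \<Rightarrow> int) \<Rightarrow> nat" where
  "anti_count n [] y = of_bool (y = id)"
| "anti_count n (q # qs) y =
     anti_count n qs (y \<circ> simple_transposition n q) +
     of_bool (y (int q) < y (int q + 1)) * anti_count n qs y"

text \<open>
  In the Hecke algebra with \<open>T_s\<^sup>2 = 1 - T_s\<close> this says that left and right
  multiplication by the inverses \<open>T_s + 1\<close> of the generators commute.
\<close>

lemma dist_count_commute:
  assumes n: "2 \<le> n" and "affine_permutation n x"
  shows "dist_count n qs (x \<circ> simple_transposition n r) g +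
      of_bool (x (int r) < x (int r + 1)) * dist_count n qs x g =
    dist_count n qs x (g \<circ> simple_transposition n r) +
      of_bool (g (int r) < g (int r + 1)) * dist_count n qs x g"
  using assms(2)
proof (induction qs arbitrary: x)
  case Nil
  have "x \<circ> simple_transposition n r = g \<longleftrightarrow> x = g \<circ> simple_transposition n r"
    using simple_transposition_involution[OF n] by (metis comp_assoc comp_id eq_id_iff o_apply)
  then show ?case by (simp only: dist_count.simps of_bool_def) auto
next
  case (Cons q qs)
  let ?s = "simple_transposition n q" and ?t = "simple_transposition n r"
  let ?N = "\<lambda>x. dist_count n qs x g" and ?N' = "\<lambda>x. dist_count n qs x (g \<circ> ?t)"
  define \<gamma> \<alpha> \<alpha>' \<beta> \<beta>' where "\<gamma> \<longleftrightarrow> g (int r) < g (int r + 1)"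
    and "\<alpha> \<longleftrightarrow> x (int r) < x (int r + 1)"
    and "\<alpha>' \<longleftrightarrow> (?s \<circ> x) (int r) < (?s \<circ> x) (int r + 1)"
    and "\<beta> \<longleftrightarrow> inv x (int q) < inv x (int q + 1)"
    and "\<beta>' \<longleftrightarrow> inv (x \<circ> ?t) (int q) < inv (x \<circ> ?t) (int q + 1)"
  note defs = this
  have x: "affine_permutation n x" by fact
  have s: "affine_permutation n ?s" and t: "affine_permutation n ?t"
    using n by (simp_all add: affine_permutation_simple_transposition)
  have inv: "inv (x \<circ> ?t) = ?t \<circ> inv x"
    using x t by (simp add: o_inv_distrib affine_permutation_def inv_simple_transposition[OF n])
  have neq: "x (int r) \<noteq> x (int r + 1)" "inv x (int q) \<noteq> inv x (int q + 1)"
    using affine_permutation_inv_apply[OF x] by (metis add.commute add_cancel_right_right zero_neq_one)+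
  let ?ex = "exchanged n q (x (int r)) (x (int r + 1))"
  have \<alpha>': "\<alpha>' \<longleftrightarrow> (if ?ex then \<not> \<alpha> else \<alpha>)"
    using simple_transposition_less_iff[OF n neq(1)] by (simp add: defs)
  have \<beta>': "\<beta>' \<longleftrightarrow> (if ?ex then \<not> \<beta> else \<beta>)"
    using simple_transposition_less_iff[OF n neq(2)] by (simp add: defs inv exchanged_inv_iff[OF n x])
  have IH1: "?N (?s \<circ> x \<circ> ?t) + of_bool \<alpha>' * ?N (?s \<circ> x) = ?N' (?s \<circ> x) + of_bool \<gamma> * ?N (?s \<circ> x)"
    using Cons.IH[OF affine_permutation_comp[OF s x]] unfolding defs .
  have IH2: "?N (x \<circ> ?t) + of_bool \<alpha> * ?N x = ?N' x + of_bool \<gamma> * ?N x"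
    using Cons.IH[OF x] unfolding defs .
  \<comment> \<open>The right side is that of \<open>IH1\<close> plus \<beta> times that of
    \<open>IH2\<close>. So is the left side: term by term if the order data are unchanged, and
    otherwise after regrouping, since then s_q x = x s_r and \<alpha> = \<beta>.\<close>
  have goal: "(?N (?s \<circ> x \<circ> ?t) + of_bool \<beta>' * ?N (x \<circ> ?t)) +
      of_bool \<alpha> * (?N (?s \<circ> x) + of_bool \<beta> * ?N x) =
    (?N' (?s \<circ> x) + of_bool \<beta> * ?N' x) + of_bool \<gamma> * (?N (?s \<circ> x) + of_bool \<beta> * ?N x)"
  proof (cases ?ex)
    case True
    have comm: "?s \<circ> x = x \<circ> ?t" by (rule exchanged_imp_commute[OF n x True])
    have "\<alpha> \<longleftrightarrow> \<beta>"
    proof -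
      obtain p where p: "p mod int n = int q mod int n"
        "x (int r) = p \<and> x (int r + 1) = p + 1 \<or> x (int r) = p + 1 \<and> x (int r + 1) = p"
        using True unfolding exchanged_def by blast
      have "inv x p < inv x (p + 1) \<longleftrightarrow> \<alpha>"
        using p(2) affine_permutation_inv_apply(1)[OF x]
        unfolding defs by (metis less_add_one not_less_iff_gr_or_eq)
      then show ?thesis
        using less_mod_eq_iff[OF affine_permutation_inv[OF x] p(1)] by (simp add: defs)
    qed
    moreover have "x \<circ> ?t \<circ> ?t = x" using n by auto
    ultimately show ?thesis
      using IH1 IH2 True unfolding \<alpha>' \<beta>' comm
      by (cases \<alpha>; cases \<gamma>) (simp_all del: o_apply)
  next
    case False
    then show ?thesis
      using IH1 IH2 unfolding \<alpha>' \<beta>' by (cases \<alpha>; cases \<beta>; cases \<gamma>) (simp_all del: o_apply)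
  qed
  then show ?case unfolding defs by (simp only: dist_count.simps comp_assoc)
qed

text \<open>The first letter acts on the identity, hence equally from the right;
  \<open>dist_count_commute\<close> moves it onto the target, where it is the first step of
  \<open>anti_count\<close>. The induction therefore needs an arbitrary target.\<close>

lemma dist_count_id_eq_anti_count:
  assumes n: "2 \<le> n"
  shows "dist_count n qs id g = anti_count n qs g"
proof (induction qs arbitrary: g)
  case Nil
  show ?case by auto
next
  case (Cons r qs)
  have "affine_permutation n id" by (simp add: affine_permutation_def)
  from dist_count_commute[OF n this, of qs r g]
  have "dist_count n qs (simple_transposition n r) g + dist_count n qs id g =
      dist_count n qs id (g \<circ> simple_transposition n r) +
      of_bool (g (int r) < g (int r + 1)) * dist_count n qs id g"
    unfolding id_comp by simp
  then show ?case
    unfolding dist_count.simps anti_count.simps comp_id Cons.IH by simp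
qed

text \<open>Shifting the labels preserves their order, hence every guard, and commutes with left
  multiplication. This removes the offset K in the starting positions.\<close>

lemma dist_count_shift:
  assumes n: "2 \<le> n" and "affine_permutation n x"
  shows "dist_count n qs (x \<circ> (\<lambda>i. i + c)) g = dist_count n qs x (g \<circ> (\<lambda>i. i - c))"
  using assms(2)
proof (induction qs arbitrary: x)
  case Nil
  have "x \<circ> (\<lambda>i. i + c) = g \<longleftrightarrow> x = g \<circ> (\<lambda>i. i - c)" by (auto simp: fun_eq_iff) (metis diff_add_cancel)
  then show ?case by (simp only: dist_count.simps)
next
  case (Cons q qs)
  have "inv (x \<circ> (\<lambda>i. i + c)) = (\<lambda>i. i - c) \<circ> inv x"
  proof (rule inv_unique_comp)
    have "x (inv x i - c + c) = i" for i using Cons.prems by simp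
    then show "(x \<circ> (\<lambda>i. i + c)) \<circ> ((\<lambda>i. i - c) \<circ> inv x) = id" by auto
    show "((\<lambda>i. i - c) \<circ> inv x) \<circ> (x \<circ> (\<lambda>i. i + c)) = id"
      using Cons.prems by auto
  qed
  then have "inv (x \<circ> (\<lambda>i. i + c)) (int q) < inv (x \<circ> (\<lambda>i. i + c)) (int q + 1) \<longleftrightarrow>
      inv x (int q) < inv x (int q + 1)"
    by simp
  moreover have "affine_permutation n (simple_transposition n q \<circ> x)"
    using Cons.prems affine_permutation_comp affine_permutation_simple_transposition[OF n] by blast
  note Cons.IH[OF this]
  ultimately show ?case
    unfolding dist_count.simps comp_assoc[symmetric] Cons.IH[OF Cons.prems] by (simp only:)
qed

section \<open>The boundary path\<close>

text \<open>Both kinds of step give n at least 2, so that the simple transpositions are involutions,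
  and positive \<open>W\<close> and \<open>K\<close>, on which the growth of \<open>time\<close>
  along strands rests.\<close>

locale boundary_path =
  fixes P :: "step list"
  assumes Right_in: "Right \<in> set P" and Up_in: "Up \<in> set P"
begin

text \<open>Each step raises the coordinate sum by 1, so the ordinate of vertex i is
  \<open>i - X i\<close> and the abscissa alone encodes the path.\<close>

definition X :: "int \<Rightarrow> int" where "X i = fst (ext_vertex P i)"

abbreviation N :: int where "N \<equiv> int (length P)"
abbreviation W :: int where "W \<equiv> width P"
abbreviation K :: int where "K \<equiv> height P"

lemma width_plus_height: "width Q + height Q = int (length Q)"
proof (induction Q)
  case (Cons s Q)
  then show ?case by (cases s) (auto simp: width_def height_def)
qed (simp add: width_def height_def)

lemma W_pos: "0 < W" and K_pos: "0 < K" and N_eq: "N = W + K" and N_pos: "0 < N" and N_ge_2: "2 \<le> N"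
proof -
  show *: "0 < W" "0 < K"
    using Right_in Up_in count_list_0_iff[of P] by (auto simp: width_def height_def)
  show "N = W + K" by (simp add: width_plus_height)
  with * show "0 < N" "2 \<le> N" by linarith+
qed

lemma ext_vertex_eq:
  assumes "r \<le> length P"
  shows "ext_vertex P (q * N + int r) =
    (q * W + width (take r P), q * K + height (take r P))"
proof (cases "r = length P")
  case True
  then have "q * N + int r = (q + 1) * N" by (simp add: algebra_simps)
  then have "(q * N + int r) div N = q + 1" "(q * N + int r) mod N = 0"
    using N_pos by simp_all
  then show ?thesis
    using True by (simp add: ext_vertex_def Let_def algebra_simps width_def height_def)
next
  case False
  with assms have "0 \<le> int r" "int r < N" by simp_all
  then have "(q * N + int r) div N = q" "(q * N + int r) mod N = int r"
    using N_pos by simp_all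
  then show ?thesis by (simp add: ext_vertex_def Let_def)
qed

lemma int_decomp:
  obtains q r where "i = q * N + int r" "r < length P"
proof
  show "i = (i div N) * N + int (nat (i mod N))" using N_pos by simp
  show "nat (i mod N) < length P" using N_pos by (simp add: nat_less_iff)
qed

lemma ext_vertex_sum: "snd (ext_vertex P i) = i - X i"
proof -
  obtain q r where i: "i = q * N + int r" "r < length P" by (rule int_decomp)
  have "q * (W + K) + (width (take r P) + height (take r P)) = q * N + int r"
    unfolding width_plus_height N_eq[symmetric] using i by simp
  then show ?thesis using i ext_vertex_eq[of r q] by (simp add: X_def algebra_simps)
qed

lemma X_period: "X (i + j * N) = X i + j * W"
proof -
  obtain q r where i: "i = q * N + int r" "r < length P" by (rule int_decomp)
  then have "i + j * N = (q + j) * N + int r" by (simp add: algebra_simps)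
  then show ?thesis
    using i ext_vertex_eq[of r q] ext_vertex_eq[of r "q + j"] by (simp add: X_def algebra_simps)
qed

lemma X_step: "X i = X (i - 1) + (if ext_step P i = Right then 1 else 0)"
proof -
  obtain q r where i: "i - 1 = q * N + int r" "r < length P" by (rule int_decomp)
  then have i': "i = q * N + int (Suc r)" by simp
  have "(i - 1) mod N = int r" unfolding i(1) using i(2) by (simp add: zmod_trivial_iff)
  then have "ext_step P i = P ! r" by (simp add: ext_step_def)
  moreover have "X (i - 1) = q * W + width (take r P)"
    using i(2) ext_vertex_eq[of r q] by (simp add: X_def i(1))
  moreover have "X i = q * W + width (take (Suc r) P)"
    using i(2) ext_vertex_eq[of "Suc r" q] unfolding i' by (simp add: X_def del: of_nat_Suc)
  ultimately show ?thesis using i(2) by (simp add: take_Suc_conv_app_nth width_def)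
qed

lemma X_step_cases: "X i = X (i - 1) \<or> X i = X (i - 1) + 1"
  using X_step[of i] by auto

lemma X_mono:
  assumes "i \<le> j" shows "X i \<le> X j"
  using assms
proof (induction j rule: int_ge_induct)
  case (step j)
  then show ?case using X_step_cases[of "j + 1"] by auto
qed simp

text \<open>The quantity is the functional \<open>K * a - W * b\<close> at vertex i. It is periodic
  in i, so a crude estimate over one period is enough.\<close>

lemma X_bound: "\<bar>X i * N - W * i\<bar> \<le> N * N"
proof -
  obtain q r where i: "i = q * N + int r" "r < length P" by (rule int_decomp)
  have Xi: "X i = q * W + width (take r P)"
    using i ext_vertex_eq[of r q] by (simp add: X_def)
  have 0: "X i * N - W * i = width (take r P) * N - W * int r"
    unfolding Xi by (simp add: i(1) algebra_simps)
  have "0 \<le> width (take r P)" "0 \<le> height (take r P)" by (simp_all add: width_def height_def)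
  with width_plus_height[of "take r P"] i(2)
  have 1: "0 \<le> width (take r P)" "width (take r P) \<le> N" by auto
  have 2: "0 \<le> W" "W \<le> N" "0 \<le> int r" "int r \<le> N" using W_pos K_pos N_eq i(2) by auto
  have "0 \<le> width (take r P) * N" "width (take r P) * N \<le> N * N"
    "0 \<le> W * int r" "W * int r \<le> N * N"
    using 1 2 by (auto intro: mult_right_mono mult_mono)
  then show ?thesis unfolding 0 by linarith
qed

text \<open>
  A monotone lattice path is given by the function sending \<open>d\<close> to the abscissa of its vertex
  on the antidiagonal \<open>x + y = d\<close>; step \<open>d\<close> ends there.
\<close>

definition edge_at :: "(int \<Rightarrow> int) \<Rightarrow> int \<Rightarrow> edge" where
  "edge_at x d =
     (if x d = x (d - 1) then Ver (x (d - 1)) (d - 1 - x (d - 1))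
      else Hor (x (d - 1)) (d - 1 - x (d - 1)))"

lemma south_edge_eq: "south_edge P i = edge_at X i"
  using X_step[of i] ext_vertex_sum[of "i - 1"]
  by (cases "ext_step P i") (auto simp: south_edge_def edge_of_step_def edge_at_def X_def)

text \<open>Raising an edge by K moves it K antidiagonals further, which is why strand i will start
  at position i + K.\<close>

lemma north_edge_eq: "north_edge P i = edge_at (\<lambda>d. X (d - K)) (i + K)"
proof -
  have "i + K - 1 - K = i - 1" by simp
  then show ?thesis
    using X_step[of i] ext_vertex_sum[of "i - 1"]
    by (cases "ext_step P i") (auto simp: north_edge_def edge_of_step_def edge_at_def X_def)
qed

text \<open>The other diagonal of the box lies on the antidiagonal d = a + b + 1, which the northern
  boundary meets at abscissa \<open>X (d - K)\<close> and the southern one at \<open>X d\<close>;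
  the box must fit between them.\<close>

lemma strip_iff: "(a, b) \<in> strip P \<longleftrightarrow> X (a + b + 1 - K) \<le> a \<and> a < X (a + b + 1)"
proof -
  have edge: "south_edge P i = Hor a y \<longleftrightarrow> X (i - 1) = a \<and> X i = a + 1 \<and> y = i - 1 - a" for i y
    using X_step_cases[of i] by (auto simp: south_edge_eq edge_at_def)
  show ?thesis
  proof
    assume "(a, b) \<in> strip P"
    then obtain i where i: "X (i - 1) = a" "X i = a + 1" "i - 1 - a \<le> b" "b < i - 1 - a + K"
      by (auto simp: strip_def edge)
    then show "X (a + b + 1 - K) \<le> a \<and> a < X (a + b + 1)"
      using X_mono[of "a + b + 1 - K" "i - 1"] X_mono[of i "a + b + 1"] by simp
  next
    assume *: "X (a + b + 1 - K) \<le> a \<and> a < X (a + b + 1)"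
    \<comment> \<open>A discrete intermediate value argument: \<open>X\<close> grows by 0 or 1, so
      some step leads from a to a + 1. It is the horizontal southern edge in the column of the
      box.\<close>
    have "\<exists>i. i0 \<le> i \<and> i < j \<and> X i = a \<and> X (i + 1) = a + 1"
      if "i0 \<le> j" "X i0 \<le> a" "a < X j" for i0 j
      using that
    proof (induction j rule: int_ge_induct)
      case (step j)
      show ?case
      proof (cases "a < X j")
        case True
        with step show ?thesis by force
      next
        case False
        with step X_step_cases[of "j + 1"] show ?thesis by (intro exI[of _ j]) auto
      qed
    qed simp
    from this[of "a + b + 1 - K" "a + b + 1"] * K_pos obtain i
      where "a + b + 1 - K \<le> i" "i < a + b + 1" "X i = a" "X (i + 1) = a + 1" by auto
    then show "(a, b) \<in> strip P"
      by (auto simp: strip_def edge intro!: exI[of _ "i + 1"])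
  qed
qed

lemma strip_translate: "(a + j * W, b + j * K) \<in> strip P \<longleftrightarrow> (a, b) \<in> strip P"
proof -
  have "a + j * W + (b + j * K) + 1 = (a + b + 1) + j * N"
    "a + j * W + (b + j * K) + 1 - K = (a + b + 1 - K) + j * N"
    by (simp_all add: N_eq algebra_simps)
  then show ?thesis unfolding strip_iff by (simp only: X_period) simp
qed

section \<open>Sweeping the strip\<close>

text \<open>
  The functional \<open>K * a - W * b\<close> is invariant under the period \<open>(W, K)\<close> and increases along
  the strands. Adding the residue of the antidiagonal breaks ties, so that the boxes swept
  at one time are the translates of a single box; the offset makes the times in the strip
  nonnegative.
\<close>

definition time :: "box \<Rightarrow> int" where
  "time B = N * (K * fst B - W * snd B + 2 * (N * N)) + (fst B + snd B) mod N"

text \<open>In the strip the functional with its offset is at most \<open>4 * (N * N)\<close>, and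
  the residue contributes less than N.\<close>

definition horizon :: nat where
  "horizon = nat (N * (4 * (N * N) + 1))"

lemma time_translate: "time (a + j * W, b + j * K) = time (a, b)"
proof -
  have "a + j * W + (b + j * K) = (a + b) + j * N" by (simp add: N_eq algebra_simps)
  then have "(a + j * W + (b + j * K)) mod N = (a + b) mod N" by (metis mod_mult_self3 add.commute)
  then show ?thesis by (simp add: time_def algebra_simps)
qed

lemma time_mod: "time (a, b) mod N = (a + b) mod N"
  by (simp add: time_def)

text \<open>One diagonal move raises the functional by K + W = N and keeps the residue. Times on an
  antidiagonal thus form an arithmetic progression, whence the division by \<open>N * N\<close> in
  \<open>cut\<close>.\<close>

lemma time_antidiagonal: "time (a + c, b - c) = time (a, b) + c * (N * N)"
  by (simp add: time_def N_eq algebra_simps)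

lemma time_mono:
  assumes "K * a - W * b < K * a' - W * b'"
  shows "time (a, b) < time (a', b')"
proof -
  have "N * (K * a - W * b + 2 * (N * N) + 1) \<le> N * (K * a' - W * b' + 2 * (N * N))"
    using assms N_pos by (intro mult_left_mono) auto
  moreover have "(a + b) mod N < N" "0 \<le> (a' + b') mod N" using N_pos by simp_all
  ultimately show ?thesis by (simp add: time_def algebra_simps)
qed

lemma time_right: "time (a, b) < time (a + 1, b)" and time_down: "time (a, b) < time (a, b - 1)"
  using W_pos K_pos by (auto intro!: time_mono simp: algebra_simps)

text \<open>Equal residues make the sums a + b differ by a multiple of N, that is, by whole periods.
  The sum and the functional together determine a box, their determinant being -N.\<close>

lemma time_eq_imp_translate:
  assumes "time (a, b) = time (a', b')"
  obtains j where "a' = a + j * W" "b' = b + j * K"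
proof -
  have res: "(a + b) mod N = (a' + b') mod N"
    using arg_cong[OF assms, of "\<lambda>t. t mod N"] by (simp add: time_mod)
  then obtain j where j: "a' + b' = a + b + j * N" by (metis mod_eqE mult.commute)
  have "N * (K * a - W * b) = N * (K * a' - W * b')"
    using assms res by (simp add: time_def algebra_simps)
  then have "K * a - W * b = K * a' - W * b'" using N_pos by simp
  moreover have "b' = a + b + j * N - a'" using j by simp
  ultimately have "N * a' = N * (a + j * W)" by (simp add: N_eq algebra_simps)
  then have "a' = a + j * W" using N_pos by simp
  moreover from this j have "b' = b + j * K" by (simp add: N_eq algebra_simps)
  ultimately show ?thesis by (rule that)
qed

lemma time_bounds:
  assumes "(a, b) \<in> strip P"
  shows "0 \<le> time (a, b)" "time (a, b) < int horizon"
proof -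
  let ?i = "a + b + 1"
  let ?g = "K * a - W * b"
  have X: "X (?i - K) \<le> a" "a < X ?i" using assms by (simp_all add: strip_iff)
  have g: "?g = a * N - W * (?i - 1)" by (simp add: N_eq algebra_simps)
  have "X (?i - K) * N \<le> a * N" "(a + 1) * N \<le> X ?i * N"
    using X N_pos by (auto intro: mult_right_mono)
  with X_bound[of "?i - K"] X_bound[of ?i]
  have *: "a * N \<ge> W * (?i - K) - N * N" "a * N + N \<le> W * ?i + N * N"
    unfolding distrib_right by linarith+
  have WK: "W * K \<le> N * N" "0 < W" "W \<le> N" using W_pos K_pos N_eq by (auto intro!: mult_mono)
  have "?g \<ge> - (2 * (N * N))" using *(1) WK unfolding g by (simp add: algebra_simps)
  then have "0 \<le> N * (?g + 2 * (N * N))" using N_pos by simp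
  then show "0 \<le> time (a, b)" using N_pos by (simp add: time_def)
  have "?g \<le> N * N" using *(2) WK unfolding g by (simp add: algebra_simps)
  moreover have "0 \<le> N * N" by simp
  ultimately have "?g + 2 * (N * N) \<le> 4 * (N * N)" by linarith
  then have "N * (?g + 2 * (N * N)) \<le> N * (4 * (N * N))" using N_pos by (intro mult_left_mono) auto
  moreover have "(a + b) mod N < N" using N_pos by simp
  ultimately have "time (a, b) < N * (4 * (N * N)) + N" by (simp add: time_def)
  also have "\<dots> = int horizon" using N_pos by (simp add: horizon_def algebra_simps)
  finally show "time (a, b) < int horizon" .
qed

text \<open>
  The cut at time \<open>t\<close> separates the boxes of the strip with time below \<open>t\<close> from the others;
  the box \<open>(a, d - 1 - a)\<close> has its other diagonal on the antidiagonal \<open>d\<close>.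
\<close>

definition cut :: "int \<Rightarrow> int \<Rightarrow> int" where
  "cut t d = min (X d) (max (X (d - K)) ((t - time (0, d - 1) + N * N - 1) div (N * N)))"

lemma cut_bounds: "X (d - K) \<le> cut t d" "cut t d \<le> X d"
  using X_mono[of "d - K" d] K_pos by (auto simp: cut_def)

text \<open>The quotient in \<open>cut\<close> is the ceiling of
  \<open>(t - time (0, d - 1)) / (N * N)\<close>, the threshold for a in the arithmetic progression
  of times on the antidiagonal; the clamping to the boundaries is invisible for boxes of the
  strip.\<close>

lemma less_cut_iff:
  assumes "X (d - K) \<le> a" "a < X d"
  shows "a < cut t d \<longleftrightarrow> time (a, d - 1 - a) < t"
proof -
  let ?c = "t - time (0, d - 1) + N * N - 1"
  have NN: "0 < N * N" using N_pos by simp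
  have "a < ?c div (N * N) \<longleftrightarrow> (a + 1) * (N * N) \<le> ?c"
  proof
    assume "a < ?c div (N * N)"
    then have "(a + 1) * (N * N) \<le> ?c div (N * N) * (N * N)"
      using NN by (intro mult_right_mono) auto
    also have "\<dots> \<le> ?c" using pos_mod_sign[OF NN, of ?c] div_mult_mod_eq[of ?c "N * N"] by linarith
    finally show "(a + 1) * (N * N) \<le> ?c" .
  next
    assume "(a + 1) * (N * N) \<le> ?c"
    from zdiv_mono1[OF this NN] show "a < ?c div (N * N)"
      unfolding nonzero_mult_div_cancel_right[OF less_imp_neq[OF NN, symmetric]] by simp
  qed
  also have "\<dots> \<longleftrightarrow> time (0, d - 1) + a * (N * N) < t" by (auto simp: algebra_simps)
  also have "time (0, d - 1) + a * (N * N) = time (a, d - 1 - a)"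
    using time_antidiagonal[of 0 a "d - 1"] by simp
  finally show ?thesis using assms by (auto simp: cut_def)
qed

lemma cut_0: "cut 0 d = X (d - K)"
proof (rule ccontr)
  assume "cut 0 d \<noteq> X (d - K)"
  then have "X (d - K) < cut 0 d" using cut_bounds[where d = d and t = 0] by simp
  with less_cut_iff[of d "X (d - K)" 0] cut_bounds[where d = d and t = 0]
  show False using time_bounds(1)[of "X (d - K)" "d - 1 - X (d - K)"] by (auto simp: strip_iff)
qed

lemma cut_horizon: "cut (int horizon) d = X d"
proof (rule ccontr)
  let ?c = "cut (int horizon) d"
  assume "?c \<noteq> X d"
  then have "?c < X d" using cut_bounds(2)[where d = d and t = "int horizon"] by simp
  with less_cut_iff[of d ?c "int horizon"] cut_bounds[where d = d and t = "int horizon"]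
  show False using time_bounds(2)[of ?c "d - 1 - ?c"] by (auto simp: strip_iff)
qed

text \<open>A cut that is not a lattice path would leave a box unswept while its lower or right
  neighbour is swept, against the growth of \<open>time\<close> to the right and downwards.\<close>

lemma cut_step: "cut t d = cut t (d - 1) \<or> cut t d = cut t (d - 1) + 1"
proof -
  let ?x = "cut t (d - 1)" and ?y = "cut t d"
  have X: "X (d - K) = X (d - 1 - K) \<or> X (d - K) = X (d - 1 - K) + 1"
    using X_step_cases[of "d - K"] by (simp add: algebra_simps)
  note bounds = X X_step_cases[of d] cut_bounds[where d = d and t = t] cut_bounds[where d = "d - 1" and t = t]
  have "?x \<le> ?y"
  proof (rule ccontr)
    assume "\<not> ?x \<le> ?y"
    then have "X (d - K) \<le> ?x - 1" "?x - 1 < X d" "X (d - 1 - K) \<le> ?x - 1" "?x - 1 < X (d - 1)"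
      using bounds by linarith+
    then have "\<not> time (?x - 1, d - ?x) < t" "time (?x - 1, d - 1 - ?x) < t"
      using less_cut_iff[of d "?x - 1" t] less_cut_iff[of "d - 1" "?x - 1" t] \<open>\<not> ?x \<le> ?y\<close>
      by (simp_all add: algebra_simps)
    then show False using time_down[of "?x - 1" "d - ?x"] by (simp add: algebra_simps)
  qed
  moreover have "?y \<le> ?x + 1"
  proof (rule ccontr)
    assume "\<not> ?y \<le> ?x + 1"
    then have "X (d - K) \<le> ?x + 1" "?x + 1 < X d" "X (d - 1 - K) \<le> ?x" "?x < X (d - 1)"
      using bounds by linarith+
    then have "time (?x + 1, d - 2 - ?x) < t" "\<not> time (?x, d - 2 - ?x) < t"
      using less_cut_iff[of d "?x + 1" t] less_cut_iff[of "d - 1" ?x t] \<open>\<not> ?y \<le> ?x + 1\<close>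
      by (simp_all add: algebra_simps)
    then show False using time_right[of ?x "d - 2 - ?x"] by simp
  qed
  ultimately show ?thesis by linarith
qed

end

section \<open>Strands and their positions\<close>

context boundary_path begin

lemma edge_at_diagonal:
  assumes "entered_box (edge_at x d) = (a, b)"
  shows "edge_at x d = Ver a b \<and> d = a + b + 1 \<or> edge_at x d = Hor a (b + 1) \<and> d = a + b + 2"
  using assms by (auto simp: edge_at_def split: if_splits)

lemma edge_at_eqD: "edge_at x d = edge_at y d' \<Longrightarrow> d = d'"
  by (auto simp: edge_at_def split: if_splits)

lemma entered_box_time:
  assumes "entered_box (edge_at (cut t) d) \<in> strip P"
  shows "t \<le> time (entered_box (edge_at (cut t) d))"
proof -
  obtain a b where ab: "entered_box (edge_at (cut t) d) = (a, b)" by fastforce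
  have *: "(a, b) \<in> strip P" using assms ab by simp
  have "cut t (a + b + 1) \<le> a"
    using ab by (auto simp: edge_at_def split: if_splits)
  then have "\<not> time (a, b) < t"
    using less_cut_iff[of "a + b + 1" a t] * by (simp add: strip_iff)
  then show ?thesis using ab by simp
qed

lemma cut_Suc_eq:
  assumes "\<And>a. (a, d - 1 - a) \<in> strip P \<Longrightarrow> time (a, d - 1 - a) \<noteq> t"
  shows "cut (t + 1) d = cut t d"
proof (rule ccontr)
  assume neq: "cut (t + 1) d \<noteq> cut t d"
  define a where "a = min (cut (t + 1) d) (cut t d)"
  have a: "X (d - K) \<le> a" "a < X d"
    using neq cut_bounds[where d = d and t = t] cut_bounds[where d = d and t = "t + 1"]
    by (auto simp: a_def)
  then have "time (a, d - 1 - a) \<noteq> t" using assms[of a] by (simp add: strip_iff)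
  with less_cut_iff[OF a, of t] less_cut_iff[OF a, of "t + 1"] have "a < cut t d \<longleftrightarrow> a < cut (t + 1) d"
    by auto
  with neq show False by (auto simp: a_def min_def split: if_splits)
qed

lemma cut_Suc_eq_mod:
  assumes "d mod N \<noteq> (t + 1) mod N"
  shows "cut (t + 1) d = cut t d"
proof (rule cut_Suc_eq)
  fix a
  have "time (a, d - 1 - a) mod N = (d - 1) mod N" by (simp add: time_mod)
  moreover have "(d - 1) mod N \<noteq> t mod N"
    using assms mod_add_one_eq_iff[of "d - 1" N t] by simp
  ultimately show "time (a, d - 1 - a) \<noteq> t" by auto
qed

text \<open>Sweeping a box flips the corner of the cut from its left and top sides to its bottom and
  right sides. Only the vertex on the antidiagonal a + b + 1 moves; its neighbours have other
  residues modulo N, and being on a lattice path before and after the flip determines them.\<close>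

lemma cut_at_box:
  assumes B: "(a, b) \<in> strip P" and t: "time (a, b) = t"
  shows "edge_at (cut t) (a + b + 1) = Ver a b"
    "edge_at (cut t) (a + b + 2) = Hor a (b + 1)"
    "edge_at (cut (t + 1)) (a + b + 1) = Hor a b"
    "edge_at (cut (t + 1)) (a + b + 2) = Ver (a + 1) b"
proof -
  let ?d = "a + b + 1"
  have X: "X (?d - K) \<le> a" "a < X ?d" using B by (simp_all add: strip_iff)
  have ld: "\<not> a < cut t ?d" "a < cut (t + 1) ?d"
    using less_cut_iff[OF X, of t] less_cut_iff[OF X, of "t + 1"] t by simp_all
  have "cut (t + 1) ?d \<le> a + 1"
  proof (rule ccontr)
    assume *: "\<not> cut (t + 1) ?d \<le> a + 1"
    then have "X (?d - K) \<le> a + 1" "a + 1 < X ?d"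
      using X cut_bounds[where d = ?d and t = "t + 1"] by linarith+
    from less_cut_iff[OF this, of "t + 1"] * have "time (a + 1, b - 1) < t + 1" by simp
    then show False
      using time_right[of a b] time_down[of "a + 1" b] t by linarith
  qed
  moreover have "a \<le> cut t ?d"
  proof (rule ccontr)
    assume *: "\<not> a \<le> cut t ?d"
    then have "X (?d - K) \<le> a - 1" "a - 1 < X ?d"
      using X cut_bounds[where d = ?d and t = t] by linarith+
    from less_cut_iff[OF this, of t] * have "\<not> time (a - 1, b + 1) < t" by simp
    then show False
      using time_right[of "a - 1" "b + 1"] time_down[of a "b + 1"] t by simp
  qed
  ultimately have d: "cut t ?d = a" "cut (t + 1) ?d = a + 1" using ld by linarith+
  have n: "2 \<le> length P" using N_ge_2 by simp
  have td: "(t + 1) mod N = ?d mod N"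
    using time_mod[of a b] t by (metis mod_add_left_eq)
  have "?d mod N \<noteq> (?d - 1) mod N" "(?d + 1) mod N \<noteq> ?d mod N"
    using mod_Suc_neq[OF n, of "?d - 1"] mod_Suc_neq[OF n, of ?d] by simp_all
  then have same: "cut (t + 1) (?d - 1) = cut t (?d - 1)" "cut (t + 1) (?d + 1) = cut t (?d + 1)"
    using td by (auto intro!: cut_Suc_eq_mod)
  have below: "cut t (?d - 1) = a"
    using cut_step[of t ?d] cut_step[of "t + 1" ?d] d same by linarith
  have above: "cut t (?d + 1) = a + 1"
    using cut_step[of t "?d + 1", unfolded add_diff_cancel_right']
      cut_step[of "t + 1" "?d + 1", unfolded add_diff_cancel_right'] d same by linarith
  note eqs = d below above same[unfolded below above]
  show "edge_at (cut t) (a + b + 1) = Ver a b" "edge_at (cut (t + 1)) (a + b + 1) = Hor a b"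
    using eqs by (simp_all add: edge_at_def)
  have e: "a + b + 2 = ?d + 1" "?d + 1 - 1 = ?d" by simp_all
  show "edge_at (cut t) (a + b + 2) = Hor a (b + 1)" "edge_at (cut (t + 1)) (a + b + 2) = Ver (a + 1) b"
    unfolding edge_at_def e using eqs by simp_all
qed

lemma box_on_antidiagonal:
  assumes "B \<in> strip P" "p mod N = (time B + 1) mod N"
  obtains a b where "(a, b) \<in> strip P" "time (a, b) = time B" "a + b + 1 = p"
proof -
  obtain a b where B: "B = (a, b)" by fastforce
  have "p mod N = (a + b + 1) mod N"
    using assms(2) time_mod[of a b] unfolding B by (metis mod_add_left_eq)
  then obtain j where "p = a + b + 1 + j * N" by (metis mod_eqE mult.commute)
  then have "(a + j * W) + (b + j * K) + 1 = p" by (simp add: N_eq algebra_simps)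
  then show ?thesis
    using that[of "a + j * W" "b + j * K"] assms(1) strip_translate time_translate
    unfolding B by blast
qed

definition active_times :: "nat set" where
  "active_times = {m. \<exists>B \<in> strip P. time B = int m}"

lemma active_times_subset: "active_times \<subseteq> {..<horizon}"
  using time_bounds(2) by (force simp: active_times_def)

text \<open>A box of time m has a + b congruent to m, but the position of its left edge is a + b +
  1; hence the index m + 1, which need not be reduced modulo n.\<close>

abbreviation sigma :: "nat \<Rightarrow> int \<Rightarrow> int" where
  "sigma m \<equiv> simple_transposition (length P) (m + 1)"

text \<open>The position of a strand is the antidiagonal index of its edge on the current cut. It is
  defined from the crossing times alone, so that fillings can be counted as sets of times.\<close>

fun label_pos :: "nat set \<Rightarrow> nat \<Rightarrow> int \<Rightarrow> int" where
  "label_pos C 0 = (\<lambda>i. i + K)"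
| "label_pos C (Suc m) = (if m \<in> C then sigma m \<circ> label_pos C m else label_pos C m)"

lemma length_ge_2: "2 \<le> length P"
  using N_ge_2 by simp

lemma affine_permutation_label_pos: "affine_permutation (length P) (label_pos C m)"
proof (induction m)
  case 0
  have "bij (\<lambda>i. i + K)" by (rule o_bij[where g = "\<lambda>i. i - K"]) auto
  then show ?case by (simp add: affine_permutation_def)
next
  case (Suc m)
  then show ?case
    using affine_permutation_comp affine_permutation_simple_transposition[OF length_ge_2]
    by simp
qed

lemma label_pos_eq_iff: "label_pos C m i = label_pos C m j \<longleftrightarrow> i = j"
  using affine_permutation_inv_apply(1)[OF affine_permutation_label_pos] by metis

definition crossing_set :: "filling \<Rightarrow> nat set" where
  "crossing_set D = {m. \<exists>B. D B = Some Crossing \<and> time B = int m}"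

definition crosses :: "nat set \<Rightarrow> int \<Rightarrow> int \<Rightarrow> nat \<Rightarrow> bool" where
  "crosses C i j m \<longleftrightarrow> m \<in> C \<and> exchanged (length P) (m + 1) (label_pos C m i) (label_pos C m j)"

text \<open>A transposition reverses the order of two strands exactly when it swaps these two, so
  each of their crossings flips the order and nothing else does.\<close>

lemma crossing_parity:
  assumes "i \<noteq> j" "m \<le> m'"
  shows "even (card {t. m \<le> t \<and> t < m' \<and> crosses C i j t}) \<longleftrightarrow>
    (label_pos C m i < label_pos C m j \<longleftrightarrow> label_pos C m' i < label_pos C m' j)"
  using assms(2)
proof (induction m' rule: dec_induct)
  case base
  have empty: "{t. m \<le> t \<and> t < m \<and> crosses C i j t} = {}" by auto
  show ?case unfolding empty by simp
next
  case (step k)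
  let ?S = "\<lambda>k. {t. m \<le> t \<and> t < k \<and> crosses C i j t}"
  have S: "?S (Suc k) = (if crosses C i j k then insert k (?S k) else ?S k)"
    using step by (auto simp: less_Suc_eq)
  have "finite (?S k)" "k \<notin> ?S k" by auto
  then have card: "card (?S (Suc k)) = (if crosses C i j k then Suc (card (?S k)) else card (?S k))"
    unfolding S by simp
  have neq: "label_pos C k i \<noteq> label_pos C k j" using assms(1) by (simp add: label_pos_eq_iff)
  have "label_pos C (Suc k) i < label_pos C (Suc k) j \<longleftrightarrow>
    (if crosses C i j k then \<not> label_pos C k i < label_pos C k j else label_pos C k i < label_pos C k j)"
    using simple_transposition_less_iff[OF length_ge_2 neq, of "k + 1"] by (simp add: crosses_def)
  with card step.IH show ?case by (cases "crosses C i j k") auto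
qed

end

section \<open>Strands of a periodic filling, followed through the sweep\<close>

locale filled_strip = boundary_path +
  fixes D :: filling
  assumes filling: "periodic_filling P D"
begin

abbreviation crossing_times :: "nat set" where "crossing_times \<equiv> crossing_set D"

lemma dom_D: "dom D = strip P"
  using filling by (simp add: periodic_filling_def)

lemma filling_translate: "D (a + j * W, b + j * K) = D (a, b)"
proof (induction j rule: int_induct[where k = 0])
  case (step1 j)
  have "D ((a + j * W) + W, (b + j * K) + K) = D (a + j * W, b + j * K)"
    using filling unfolding periodic_filling_def by blast
  with step1 show ?case by (simp add: algebra_simps)
next
  case (step2 j)
  have "D ((a + (j - 1) * W) + W, (b + (j - 1) * K) + K) = D (a + (j - 1) * W, b + (j - 1) * K)"
    using filling unfolding periodic_filling_def by blast
  with step2 show ?case by (simp add: algebra_simps)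
qed simp

lemma crossing_times_iff:
  assumes "time B = int m"
  shows "m \<in> crossing_times \<longleftrightarrow> D B = Some Crossing"
proof
  assume "m \<in> crossing_times"
  then obtain B' where B': "D B' = Some Crossing" "time B = time B'"
    using assms by (auto simp: crossing_set_def)
  obtain a b a' b' where ab: "B = (a, b)" "B' = (a', b')" by fastforce
  with B'(2) obtain j where "a' = a + j * W" "b' = b + j * K"
    using time_eq_imp_translate by metis
  with B'(1) show "D B = Some Crossing" by (simp add: ab filling_translate)
qed (use assms crossing_set_def in blast)

lemma time_nat:
  assumes "B \<in> strip P"
  obtains m where "time B = int m" "m < horizon" "m \<in> active_times"
proof -
  have "0 \<le> time B" "time B < int horizon" using assms time_bounds by (cases B; blast)+
  then have "time B = int (nat (time B))" "nat (time B) < horizon" by simp_all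
  with assms that[of "nat (time B)"] show ?thesis unfolding active_times_def by blast
qed

lemma crossing_times_subset: "crossing_times \<subseteq> active_times"
  using dom_D by (auto simp: crossing_set_def active_times_def)

lemma elbow_iff:
  assumes "time B = int m" "B \<in> strip P"
  shows "D B = Some Elbow \<longleftrightarrow> m \<notin> crossing_times"
proof -
  obtain t where "D B = Some t" using assms(2) dom_D by blast
  then show ?thesis using crossing_times_iff[OF assms(1)] by (cases t) auto
qed

abbreviation pos :: "nat \<Rightarrow> int \<Rightarrow> int" where "pos \<equiv> label_pos crossing_times"

text \<open>The strand is parametrised by sweep time instead of box count: it rests on an edge until
  the box entered from there is swept.\<close>

definition strand_edge :: "int \<Rightarrow> nat \<Rightarrow> edge" where
  "strand_edge i m = edge_at (cut (int m)) (pos m i)"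

text \<open>The two positions are those of the left and top edges. A crossing swaps them and an
  elbow keeps them, while the cut flips around the box; together this yields the prescribed exit
  edge.\<close>

lemma strand_edge_at_box:
  assumes B: "(a, b) \<in> strip P" and t: "time (a, b) = int m" and u: "pos m i \<in> {a + b + 1, a + b + 2}"
  shows "entered_box (strand_edge i m) = (a, b)"
    "advance D (strand_edge i m) (strand_edge i (Suc m))"
proof -
  note e = cut_at_box[OF B t]
  have p: "(a + b + 1) mod N = int (m + 1) mod N"
    using time_mod[of a b] t by (metis mod_add_left_eq of_nat_1 of_nat_add)
  have "a + b + 1 + 1 = a + b + 2" by simp
  with simple_transposition_simps[OF length_ge_2 p]
  have s: "sigma m (a + b + 1) = a + b + 2" "sigma m (a + b + 2) = a + b + 1" by metis+
  have Suc: "int (Suc m) = int m + 1" by simp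
  show "entered_box (strand_edge i m) = (a, b)" using u e by (auto simp: strand_edge_def)
  show "advance D (strand_edge i m) (strand_edge i (Suc m))"
  proof (cases "m \<in> crossing_times")
    case True
    then have "D (a, b) = Some Crossing" using crossing_times_iff[OF t] by simp
    then show ?thesis using True u e s unfolding strand_edge_def Suc by (auto simp: advance_def)
  next
    case False
    then have "D (a, b) = Some Elbow" using elbow_iff[OF t B] by simp
    then show ?thesis using False u e s unfolding strand_edge_def Suc by (auto simp: advance_def)
  qed
qed

lemma strand_edge_stay:
  assumes "\<not> (entered_box (strand_edge i m) \<in> strip P \<and> time (entered_box (strand_edge i m)) = int m)"
  shows "strand_edge i (Suc m) = strand_edge i m"
proof -
  have no_box: "pos m i \<notin> {a + b + 1, a + b + 2}"
    if "(a, b) \<in> strip P" "time (a, b) = int m" for a b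
    using strand_edge_at_box(1)[OF that] assms that by metis
  have Suc: "int (Suc m) = int m + 1" by simp
  have cut: "cut (int (Suc m)) d = cut (int m) d" if d: "d = pos m i \<or> d = pos m i - 1" for d
    unfolding Suc
  proof (rule cut_Suc_eq)
    fix a assume "(a, d - 1 - a) \<in> strip P"
    then show "time (a, d - 1 - a) \<noteq> int m" using no_box[of a "d - 1 - a"] d by auto
  qed
  have "pos (Suc m) i = pos m i"
  proof (cases "m \<in> crossing_times")
    case True
    then obtain B where B: "B \<in> strip P" "time B = int m"
      using crossing_times_subset by (auto simp: active_times_def)
    have "pos m i mod N \<noteq> int (m + 1) mod N"
    proof
      assume "pos m i mod N = int (m + 1) mod N"
      then have "pos m i mod N = (time B + 1) mod N" using B(2) by (simp add: add.commute)
      then obtain a b where "(a, b) \<in> strip P" "time (a, b) = time B" "a + b + 1 = pos m i"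
        using box_on_antidiagonal[OF B(1)] by metis
      with B no_box[of a b] show False by simp
    qed
    moreover have "pos m i mod N \<noteq> (int (m + 1) + 1) mod N"
    proof
      assume "pos m i mod N = (int (m + 1) + 1) mod N"
      then have "(pos m i - 1) mod N = (time B + 1) mod N"
        using mod_add_one_eq_iff[of "pos m i - 1" N "int (m + 1)"] B(2) by (simp add: add.commute)
      then obtain a b where "(a, b) \<in> strip P" "time (a, b) = time B" "a + b + 1 = pos m i - 1"
        using box_on_antidiagonal[OF B(1)] by metis
      with B no_box[of a b] show False by simp
    qed
    ultimately show ?thesis using True simple_transposition_other by simp
  qed simp
  then show ?thesis unfolding strand_edge_def edge_at_def using cut by simp
qed

lemma strand_edge_step:
  "advance D (strand_edge i m) (strand_edge i (Suc m)) \<or> strand_edge i (Suc m) = strand_edge i m"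
proof (cases "entered_box (strand_edge i m) \<in> strip P \<and> time (entered_box (strand_edge i m)) = int m")
  case True
  obtain a b where ab: "entered_box (strand_edge i m) = (a, b)" by fastforce
  then have "pos m i \<in> {a + b + 1, a + b + 2}"
    using edge_at_diagonal unfolding strand_edge_def by blast
  then show ?thesis using True strand_edge_at_box(2)[of a b m i] ab by simp
qed (simp add: strand_edge_stay)

lemma strand_edge_reach:
  assumes "m \<le> m'"
  shows "(advance D)\<^sup>*\<^sup>* (strand_edge i m) (strand_edge i m')"
  using assms
proof (induction m' rule: dec_induct)
  case (step k)
  show ?case using strand_edge_step[of i k] step(3) by (auto intro: rtranclp.rtrancl_into_rtrancl)
qed simp

lemma strand_edge_0: "strand_edge i 0 = north_edge P i"
  using cut_0 by (simp add: strand_edge_def north_edge_eq edge_at_def)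

lemma strand_edge_horizon: "strand_edge i horizon = south_edge P (pos horizon i)"
  using cut_horizon by (simp add: strand_edge_def south_edge_eq edge_at_def)

lemma on_strand_strand_edge: "on_strand P D i (strand_edge i m)"
  using strand_edge_reach[of 0 m i] strand_edge_0 by (simp add: on_strand_def)

lemma advance_unique: "advance D e e1 \<Longrightarrow> advance D e e2 \<Longrightarrow> e1 = e2"
  by (auto simp: advance_def)

lemma strand_edge_until:
  assumes B: "entered_box (strand_edge i m) = B" "B \<in> strip P" "time B = int k"
  shows "m \<le> k" "strand_edge i k = strand_edge i m"
proof -
  show mk: "m \<le> k" using entered_box_time[of "int m" "pos m i"] B by (simp add: strand_edge_def)
  have "k' \<le> k \<longrightarrow> strand_edge i k' = strand_edge i m" if "m \<le> k'" for k'
    using that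
  proof (induction k' rule: dec_induct)
    case (step l)
    show ?case
    proof
      assume "Suc l \<le> k"
      then have "strand_edge i l = strand_edge i m" using step by simp
      with strand_edge_stay[of i l] B \<open>Suc l \<le> k\<close> show "strand_edge i (Suc l) = strand_edge i m"
        by simp
    qed
  qed simp
  with mk show "strand_edge i k = strand_edge i m" by blast
qed

text \<open>\<open>advance\<close> is deterministic, and its next move takes place exactly when the
  entered box is swept.\<close>

lemma on_strandE:
  assumes "on_strand P D i e"
  obtains m where "m \<le> horizon" "e = strand_edge i m"
proof -
  have "\<exists>m \<le> horizon. e = strand_edge i m"
    using assms unfolding on_strand_def
  proof (induction rule: rtranclp_induct)
    case base
    show ?case using strand_edge_0 by (intro exI[of _ 0]) simp
  next
    case (step e e')
    then obtain m where m: "e = strand_edge i m" by blast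
    have box: "entered_box e \<in> strip P" using step(2) dom_D by (auto simp: advance_def)
    then obtain k where k: "time (entered_box e) = int k" "k < horizon" by (rule time_nat)
    have e: "strand_edge i k = e" using strand_edge_until(2)[of i m _ k] box k m by simp
    obtain a b where ab: "entered_box e = (a, b)" by fastforce
    then have "pos k i \<in> {a + b + 1, a + b + 2}"
      using edge_at_diagonal[of "cut (int k)" "pos k i" a b] e by (auto simp: strand_edge_def)
    then have "advance D e (strand_edge i (Suc k))"
      using strand_edge_at_box(2)[of a b k i] box k ab e by simp
    with step(2) have "e' = strand_edge i (Suc k)" by (rule advance_unique)
    with k(2) show ?case by (intro exI[of _ "Suc k"]) simp
  qed
  with that show ?thesis by blast
qed

lemma traverses_iff:
  assumes "(a, b) \<in> strip P" "time (a, b) = int m"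
  shows "traverses P D i (a, b) \<longleftrightarrow> pos m i \<in> {a + b + 1, a + b + 2}"
proof
  assume "traverses P D i (a, b)"
  then obtain e where e: "on_strand P D i e" "entered_box e = (a, b)" by (auto simp: traverses_def)
  then obtain k where k: "e = strand_edge i k" by (metis on_strandE)
  then have "strand_edge i m = e" using strand_edge_until(2)[of i k _ m] e assms by simp
  then show "pos m i \<in> {a + b + 1, a + b + 2}"
    using e edge_at_diagonal[of "cut (int m)" "pos m i" a b] by (auto simp: strand_edge_def)
next
  assume "pos m i \<in> {a + b + 1, a + b + 2}"
  from strand_edge_at_box(1)[OF assms this] show "traverses P D i (a, b)"
    using assms dom_D on_strand_strand_edge unfolding traverses_def by blast
qed

lemma advance_time_less:
  assumes "(advance D)\<^sup>+\<^sup>+ e e'"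
  shows "time (entered_box e) < time (entered_box e')"
proof -
  have "time (entered_box e) < time (entered_box e')" if "advance D e e'" for e e'
  proof -
    obtain t where "e' = exit_edge t e" using \<open>advance D e e'\<close> by (auto simp: advance_def)
    moreover have "time (a, b - 1) < time (a, b - 2)" for a b using time_down[of a "b - 1"] by simp
    ultimately show ?thesis
      by (cases t; cases e) (simp_all add: time_right time_down)
  qed
  with assms show ?thesis by (induction rule: tranclp_induct) (blast intro: less_trans)+
qed

text \<open>Time increases strictly along a strand, so the order of traversal, defined by
  reachability, is the order of sweep times.\<close>

lemma traverses_before_iff:
  "traverses_before P D i B C \<longleftrightarrow> traverses P D i B \<and> traverses P D i C \<and> time B < time C"
proof
  assume "traverses_before P D i B C"
  then obtain e e' where e: "B \<in> dom D" "C \<in> dom D" "on_strand P D i e" "(advance D)\<^sup>+\<^sup>+ e e'"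
    "entered_box e = B" "entered_box e' = C"
    by (auto simp: traverses_before_def)
  then have "on_strand P D i e'"
    unfolding on_strand_def by (meson rtranclp_trans tranclp_into_rtranclp)
  with e advance_time_less[OF e(4)]
  show "traverses P D i B \<and> traverses P D i C \<and> time B < time C"
    by (auto simp: traverses_def)
next
  assume *: "traverses P D i B \<and> traverses P D i C \<and> time B < time C"
  have edge: "\<exists>m. time B = int m \<and> entered_box (strand_edge i m) = B"
    if tr: "traverses P D i B" for B
  proof -
    have B: "B \<in> strip P" using tr dom_D by (auto simp: traverses_def)
    obtain m where m: "time B = int m" using B by (rule time_nat)
    obtain a b where "B = (a, b)" by fastforce
    with traverses_iff[of a b m i] strand_edge_at_box(1)[of a b m i] B m tr show ?thesis by auto
  qed
  obtain m k where m: "time B = int m" "entered_box (strand_edge i m) = B"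
    and k: "time C = int k" "entered_box (strand_edge i k) = C"
    using edge * by metis
  then have "m \<le> k" using * by simp
  then have "(advance D)\<^sup>*\<^sup>* (strand_edge i m) (strand_edge i k)" by (rule strand_edge_reach)
  moreover have "strand_edge i m \<noteq> strand_edge i k" using m k * by auto
  ultimately have "(advance D)\<^sup>+\<^sup>+ (strand_edge i m) (strand_edge i k)" by (meson rtranclpD)
  with m k * show "traverses_before P D i B C"
    using on_strand_strand_edge[of i m] unfolding traverses_before_def
    by (auto simp: traverses_def)
qed

lemma has_strand_permutation_iff: "has_strand_permutation P D f \<longleftrightarrow> pos horizon = f"
proof
  assume f: "has_strand_permutation P D f"
  show "pos horizon = f"
  proof
    fix i
    have "on_strand P D i (south_edge P (f i))" using f by (simp add: has_strand_permutation_def)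
    then obtain m where m: "m \<le> horizon" "south_edge P (f i) = strand_edge i m"
      by (rule on_strandE)
    \<comment> \<open>A box entered from the final cut would have time at least
      \<open>horizon\<close>; thus the strand stops here and this edge is also its edge at the
      horizon.\<close>
    have "\<not> advance D (south_edge P (f i)) e" for e
    proof
      assume "advance D (south_edge P (f i)) e"
      then have "entered_box (south_edge P (f i)) \<in> strip P" using dom_D by (auto simp: advance_def)
      moreover have "south_edge P (f i) = edge_at (cut (int horizon)) (f i)"
        using cut_horizon by (simp add: south_edge_eq edge_at_def)
      ultimately have "int horizon \<le> time (entered_box (south_edge P (f i)))"
        using entered_box_time by simp
      with \<open>entered_box (south_edge P (f i)) \<in> strip P\<close> show False
        using time_bounds(2) by (cases "entered_box (south_edge P (f i))") fastforce
    qed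
    with strand_edge_reach[OF m(1), of i] m(2)
    have "south_edge P (f i) = strand_edge i horizon"
      by (metis converse_rtranclpE)
    then show "pos horizon i = f i"
      unfolding strand_edge_horizon south_edge_eq using edge_at_eqD by metis
  qed
next
  assume "pos horizon = f"
  then show "has_strand_permutation P D f"
    using on_strand_strand_edge[of _ horizon]
    by (auto simp: has_strand_permutation_def strand_edge_horizon)
qed

section \<open>Crossings of two strands and the local form of the elbow conditions\<close>

lemma traverses_both_iff:
  assumes "(a, b) \<in> strip P" "time (a, b) = int m" "i \<noteq> j"
  shows "traverses P D i (a, b) \<and> traverses P D j (a, b) \<longleftrightarrow>
    pos m i = a + b + 1 \<and> pos m j = a + b + 2 \<or> pos m i = a + b + 2 \<and> pos m j = a + b + 1"
  using label_pos_eq_iff[of crossing_times m i j] assms(3)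
  unfolding traverses_iff[OF assms(1,2)] by auto

text \<open>No orbit is counted twice: two boxes of equal time are translates, and a common pair of
  strands places them on the same antidiagonal, so they coincide. \<open>R\<close> is left free to
  serve crossings before and after a box alike.\<close>

lemma card_crossings:
  assumes "i \<noteq> j"
  shows "card {C. D C = Some Crossing \<and> traverses P D i C \<and> traverses P D j C \<and> R (nat (time C))} =
    card {t. R t \<and> crosses crossing_times i j t}" (is "card ?A = card ?B")
proof -
  have strip: "C \<in> strip P" if "D C = Some Crossing" for C using that dom_D by blast
  have "inj_on (nat \<circ> time) ?A"
  proof
    fix C C' assume C: "C \<in> ?A" and C': "C' \<in> ?A" and eq: "(nat \<circ> time) C = (nat \<circ> time) C'"
    obtain a b a' b' where ab: "C = (a, b)" "C' = (a', b')" by fastforce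
    obtain m where m: "time C = int m" using strip C time_nat by blast
    obtain m' where "time C' = int m'" using strip C' time_nat by blast
    with eq m have m': "time C' = int m" by simp
    have "a + b = a' + b'"
      using traverses_both_iff[of a b m i j] traverses_both_iff[of a' b' m i j] assms m m' strip C C'
      unfolding ab by auto
    moreover obtain k where "a' = a + k * W" "b' = b + k * K"
      using time_eq_imp_translate m m' unfolding ab by metis
    ultimately have "k * (W + K) = 0" by (simp add: algebra_simps)
    with W_pos K_pos have "k = 0" by auto
    with \<open>a' = a + k * W\<close> \<open>b' = b + k * K\<close> show "C = C'" by (simp add: ab)
  qed
  moreover have "(nat \<circ> time) ` ?A = ?B"
  proof safe
    fix a b assume *: "D (a, b) = Some Crossing" "traverses P D i (a, b)" "traverses P D j (a, b)"
      "R (nat (time (a, b)))"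
    obtain m where m: "time (a, b) = int m" using strip[OF *(1)] by (rule time_nat)
    show "R ((nat \<circ> time) (a, b))" using * by simp
    have "(a + b + 1) mod N = int (m + 1) mod N"
      using time_mod[of a b] m by (metis mod_add_left_eq of_nat_1 of_nat_add)
    moreover have "m \<in> crossing_times" using crossing_times_iff[OF m] * by simp
    ultimately have "crosses crossing_times i j m"
      using traverses_both_iff[OF strip[OF *(1)] m assms] * unfolding crosses_def exchanged_def
      by (auto intro!: exI[of _ "a + b + 1"])
    then show "crosses crossing_times i j ((nat \<circ> time) (a, b))" using m by simp
  next
    fix m assume R: "R m" and "crosses crossing_times i j m"
    then obtain p where p: "m \<in> crossing_times" "p mod N = int (m + 1) mod N"
      "pos m i = p \<and> pos m j = p + 1 \<or> pos m i = p + 1 \<and> pos m j = p"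
      unfolding crosses_def exchanged_def by blast
    obtain B where B: "B \<in> strip P" "time B = int m"
      using p(1) crossing_times_subset by (auto simp: active_times_def)
    then have "p mod N = (time B + 1) mod N" using p(2) by (simp add: add.commute)
    then obtain a b where ab: "(a, b) \<in> strip P" "time (a, b) = int m" "a + b + 1 = p"
      using box_on_antidiagonal[OF B(1)] B(2) by metis
    have "traverses P D i (a, b) \<and> traverses P D j (a, b)"
      using traverses_both_iff[OF ab(1,2) assms] p(3) ab(3) by auto
    moreover have "D (a, b) = Some Crossing" using crossing_times_iff[OF ab(2)] p(1) by simp
    ultimately have "(a, b) \<in> ?A" "m = (nat \<circ> time) (a, b)" using ab(2) R by simp_all
    then show "m \<in> (nat \<circ> time) ` ?A" by (rule rev_image_eqI)
  qed
  ultimately show ?thesis using card_image[of "nat \<circ> time" ?A] by simp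
qed

lemma even_crossings_before_iff:
  assumes "i \<noteq> j" "traverses P D i B" "traverses P D j B" "time B = int m"
  shows "even (card (crossings_before P D i j B)) \<longleftrightarrow> (i < j \<longleftrightarrow> pos m i < pos m j)"
proof -
  have "nat (time C) < m \<longleftrightarrow> time C < time B" if "D C = Some Crossing" for C
    using that dom_D time_bounds(1) assms(4) by (cases C) (force simp: nat_less_iff)
  then
  have "crossings_before P D i j B =
      {C. D C = Some Crossing \<and> traverses P D i C \<and> traverses P D j C \<and> nat (time C) < m}"
    using assms(2,3) unfolding crossings_before_def traverses_before_iff by blast
  then show ?thesis
    using card_crossings[OF assms(1), of "\<lambda>t. t < m"]
      crossing_parity[OF assms(1), of 0 m crossing_times] by simp
qed

lemma even_crossings_after_iff:
  assumes "i \<noteq> j" "traverses P D i B" "traverses P D j B" "time B = int m" "D B = Some Elbow"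
  shows "even (card (crossings_after P D i j B)) \<longleftrightarrow>
    (pos horizon i < pos horizon j \<longleftrightarrow> pos m i < pos m j)"
proof -
  have B: "B \<in> strip P" using assms(5) dom_D by blast
  then have m: "m < horizon" using time_nat assms(4) by (metis of_nat_eq_iff)
  have "crossings_after P D i j B =
      {C. D C = Some Crossing \<and> traverses P D i C \<and> traverses P D j C \<and> m < nat (time C)}"
    using assms by (auto simp: crossings_after_def traverses_before_iff)
  \<comment> \<open>The box itself is an elbow, so counting from m or from just after m makes no
    difference; \<open>crossing_parity\<close> needs the former.\<close>
  moreover have "m \<notin> crossing_times" using elbow_iff[OF assms(4) B] assms(5) by simp
  then have "{t. m < t \<and> crosses crossing_times i j t} =
      {t. m \<le> t \<and> t < horizon \<and> crosses crossing_times i j t}"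
    using active_times_subset crossing_times_subset le_neq_implies_less
    unfolding crosses_def by (blast intro: less_imp_le)
  ultimately show ?thesis
    using card_crossings[OF assms(1), of "\<lambda>t. m < t"]
      crossing_parity[OF assms(1) less_imp_le[OF m], of crossing_times] by auto
qed

text \<open>\<open>\<psi>\<close> will be the identity for the condition counted from the north and
  the final position for the one counted from the south. By periodicity one box per time suffices,
  and in it the strands occupy two consecutive positions, so equality of orders becomes a single
  inequality.\<close>

lemma elbow_condition_iff:
  assumes \<psi>: "affine_permutation (length P) \<psi>"
  shows "(\<forall>B i j. D B = Some Elbow \<and> i \<noteq> j \<and> traverses P D i B \<and> traverses P D j B \<longrightarrow>
      (\<psi> i < \<psi> j \<longleftrightarrow> pos (nat (time B)) i < pos (nat (time B)) j)) \<longleftrightarrow>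
    (\<forall>m \<in> active_times - crossing_times.
      \<psi> (inv (pos m) (int (m + 1))) < \<psi> (inv (pos m) (int (m + 1) + 1)))" (is "?L \<longleftrightarrow> ?R")
proof -
  note pos_inv = affine_permutation_inv_apply[OF affine_permutation_label_pos]
  have at: "\<psi> (inv (pos m) (int (m + 1))) < \<psi> (inv (pos m) (int (m + 1) + 1)) \<longleftrightarrow>
      \<psi> (inv (pos m) (a + b + 1)) < \<psi> (inv (pos m) (a + b + 2))" if "time (a, b) = int m" for a b m
  proof -
    have "int (m + 1) mod N = (a + b + 1) mod N"
      using time_mod[of a b] that by (metis mod_add_left_eq of_nat_1 of_nat_add)
    moreover have "affine_permutation (length P) (\<psi> \<circ> inv (pos m))"
      using \<psi> affine_permutation_label_pos affine_permutation_inv affine_permutation_comp by blast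
    ultimately show ?thesis
      using less_mod_eq_iff[of "length P" "\<psi> \<circ> inv (pos m)" "int (m + 1)" "a + b + 1"]
      by (simp add: add.assoc)
  qed
  show ?thesis
  proof
    assume L: ?L
    show ?R
    proof
      fix m assume m: "m \<in> active_times - crossing_times"
      then obtain a b where ab: "(a, b) \<in> strip P" "time (a, b) = int m"
        by (auto simp: active_times_def)
      let ?i = "inv (pos m) (a + b + 1)" and ?j = "inv (pos m) (a + b + 2)"
      have "pos m ?i = a + b + 1" "pos m ?j = a + b + 2" by (simp_all add: pos_inv)
      moreover from this have neq: "?i \<noteq> ?j" by auto
      ultimately have "traverses P D ?i (a, b) \<and> traverses P D ?j (a, b)"
        using traverses_both_iff[OF ab neq] by simp
      moreover have "D (a, b) = Some Elbow" using elbow_iff[OF ab(2,1)] m by simp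
      ultimately have "\<psi> ?i < \<psi> ?j \<longleftrightarrow> pos (nat (time (a, b))) ?i < pos (nat (time (a, b))) ?j"
        using L neq by blast
      then show "\<psi> (inv (pos m) (int (m + 1))) < \<psi> (inv (pos m) (int (m + 1) + 1))"
        unfolding at[OF ab(2)] by (simp add: ab(2) pos_inv)
    qed
  next
    assume R: ?R
    show ?L
    proof (intro allI impI, elim conjE)
      fix B i j assume B: "D B = Some Elbow" and neq: "i \<noteq> j"
        and tr: "traverses P D i B" "traverses P D j B"
      obtain a b where ab: "B = (a, b)" by fastforce
      have s: "(a, b) \<in> strip P" using B ab dom_D by blast
      then obtain m where m: "time (a, b) = int m" "m \<in> active_times" by (metis time_nat)
      then have "m \<in> active_times - crossing_times" using elbow_iff[OF m(1) s] B ab by simp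
      with R have less: "\<psi> (inv (pos m) (a + b + 1)) < \<psi> (inv (pos m) (a + b + 2))"
        unfolding at[OF m(1), symmetric] by blast
      have "pos m i = a + b + 1 \<and> pos m j = a + b + 2 \<or> pos m i = a + b + 2 \<and> pos m j = a + b + 1"
        using traverses_both_iff[OF s m(1) neq] tr ab by simp
      then show "\<psi> i < \<psi> j \<longleftrightarrow> pos (nat (time B)) i < pos (nat (time B)) j"
        using less pos_inv(1)[of crossing_times m i] pos_inv(1)[of crossing_times m j]
        by (auto simp: ab m(1))
    qed
  qed
qed

lemma distinguished_iff:
  "distinguished P D \<longleftrightarrow> (\<forall>m \<in> active_times - crossing_times.
    inv (pos m) (int (m + 1)) < inv (pos m) (int (m + 1) + 1))"
proof -
  have "affine_permutation (length P) (\<lambda>i. i)"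
    by (simp add: affine_permutation_def bij_id[unfolded id_def])
  note * = elbow_condition_iff[OF this]
  have time: "time B = int (nat (time B))" if "D B = Some Elbow" for B
  proof -
    have "B \<in> strip P" using that dom_D by blast
    then show ?thesis using time_nat by (metis nat_int)
  qed
  have "distinguished P D \<longleftrightarrow>
    (\<forall>B i j. D B = Some Elbow \<and> i \<noteq> j \<and> traverses P D i B \<and> traverses P D j B \<longrightarrow>
      (i < j \<longleftrightarrow> pos (nat (time B)) i < pos (nat (time B)) j))"
    unfolding distinguished_def using even_crossings_before_iff time by blast
  then show ?thesis using * by simp
qed

lemma anti_distinguished_iff:
  "anti_distinguished P D \<longleftrightarrow> (\<forall>m \<in> active_times - crossing_times.
    pos horizon (inv (pos m) (int (m + 1))) < pos horizon (inv (pos m) (int (m + 1) + 1)))"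
proof -
  note * = elbow_condition_iff[OF affine_permutation_label_pos[of crossing_times horizon]]
  have time: "time B = int (nat (time B))" if "D B = Some Elbow" for B
  proof -
    have "B \<in> strip P" using that dom_D by blast
    then show ?thesis using time_nat by (metis nat_int)
  qed
  have "anti_distinguished P D \<longleftrightarrow>
    (\<forall>B i j. D B = Some Elbow \<and> i \<noteq> j \<and> traverses P D i B \<and> traverses P D j B \<longrightarrow>
      (pos horizon i < pos horizon j \<longleftrightarrow> pos (nat (time B)) i < pos (nat (time B)) j))"
    unfolding anti_distinguished_def using even_crossings_after_iff time by blast
  then show ?thesis using * by simp
qed

end

section \<open>Fillings as sets of crossing times\<close>

text \<open>States, moves and guards are parameters, so that one count of subsets serves both
  conditions. A time in \<open>C\<close> is a move; any other listed time is a stay that the guard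
  must permit.\<close>

fun walk :: "('s \<Rightarrow> nat \<Rightarrow> 's) \<Rightarrow> ('s \<Rightarrow> nat \<Rightarrow> bool) \<Rightarrow> ('s \<Rightarrow> bool) \<Rightarrow> nat set \<Rightarrow> nat list \<Rightarrow> 's \<Rightarrow> bool"
  where
  "walk step ok fin C [] x = fin x"
| "walk step ok fin C (m # ms) x =
     (if m \<in> C then walk step ok fin C ms (step x m) else ok x m \<and> walk step ok fin C ms x)"

fun walk_count :: "('s \<Rightarrow> nat \<Rightarrow> 's) \<Rightarrow> ('s \<Rightarrow> nat \<Rightarrow> bool) \<Rightarrow> ('s \<Rightarrow> bool) \<Rightarrow> nat list \<Rightarrow> 's \<Rightarrow> nat" where
  "walk_count step ok fin [] x = of_bool (fin x)"
| "walk_count step ok fin (m # ms) x =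
     walk_count step ok fin ms (step x m) + of_bool (ok x m) * walk_count step ok fin ms x"

lemma walk_cong:
  "C \<inter> set ms = C' \<inter> set ms \<Longrightarrow> walk step ok fin C ms x = walk step ok fin C' ms x"
proof (induction ms arbitrary: x)
  case (Cons m ms)
  then have "m \<in> C \<longleftrightarrow> m \<in> C'" "C \<inter> set ms = C' \<inter> set ms" by auto
  with Cons.IH show ?case by simp
qed simp

lemma card_walks:
  assumes "distinct ms"
  shows "card {C. C \<subseteq> set ms \<and> walk step ok fin C ms x} = walk_count step ok fin ms x"
  using assms
proof (induction ms arbitrary: x)
  case Nil
  have "{C. C \<subseteq> set [] \<and> walk step ok fin C [] x} = (if fin x then {{}} else {})" by auto
  then show ?case by simp
next
  case (Cons m ms)
  let ?S = "\<lambda>x. {C. C \<subseteq> set ms \<and> walk step ok fin C ms x}"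
  let ?T = "if ok x m then ?S x else {}"
  have m: "m \<notin> set ms" using Cons.prems by simp
  have fin: "finite (?S y)" for y by (rule finite_subset[of _ "Pow (set ms)"]) auto
  have "{C. C \<subseteq> set (m # ms) \<and> walk step ok fin C (m # ms) x} = insert m ` ?S (step x m) \<union> ?T"
    (is "?L = ?R")
  proof
    show "?L \<subseteq> ?R"
    proof
      fix C assume C: "C \<in> ?L"
      show "C \<in> ?R"
      proof (cases "m \<in> C")
        case True
        have "walk step ok fin C ms (step x m) = walk step ok fin (C - {m}) ms (step x m)"
          using m by (intro walk_cong) auto
        with C True have "C - {m} \<in> ?S (step x m)" by auto
        moreover have "C = insert m (C - {m})" using True by auto
        ultimately show ?thesis by blast
      next
        case False
        with C show ?thesis by auto
      qed
    qed
    show "?R \<subseteq> ?L"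
    proof
      fix C assume "C \<in> ?R"
      then consider C' where "C = insert m C'" "C' \<in> ?S (step x m)" | "C \<in> ?S x" "ok x m"
        by (auto split: if_splits)
      then show "C \<in> ?L"
      proof cases
        case 1
        have "walk step ok fin C ms (step x m) = walk step ok fin C' ms (step x m)"
          using m 1 by (intro walk_cong) auto
        with 1 show ?thesis by auto
      next
        case 2
        with m show ?thesis by auto
      qed
    qed
  qed
  moreover have "insert m ` ?S (step x m) \<inter> ?T = {}" using m by auto
  moreover have "inj_on (insert m) (?S (step x m))"
    using m by (auto simp: inj_on_def dest!: insert_ident[THEN iffD1, rotated -1])
  ultimately have "card {C. C \<subseteq> set (m # ms) \<and> walk step ok fin C (m # ms) x} =
      card (?S (step x m)) + card ?T"
    using fin by (simp add: card_Un_disjoint card_image)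
  with Cons show ?case by simp
qed

text \<open>Times outside \<open>A\<close> may be skipped: as \<open>C\<close> lies in
  \<open>A\<close>, the state does not change there.\<close>

lemma walk_trajectory:
  assumes "\<And>m. m < L \<Longrightarrow> st (Suc m) = (if m \<in> C then step (st m) m else st m)"
    and "C \<subseteq> A" and "m \<le> L"
  shows "walk step ok fin C (filter (\<lambda>k. k \<in> A) [m..<L]) (st m) \<longleftrightarrow>
    (\<forall>k \<in> A - C. m \<le> k \<and> k < L \<longrightarrow> ok (st k) k) \<and> fin (st L)"
  using assms(3)
proof (induction m rule: inc_induct)
  case (step m)
  have split: "(\<forall>k \<in> A - C. m \<le> k \<and> k < L \<longrightarrow> ok (st k) k) \<longleftrightarrow>
    (m \<in> A - C \<longrightarrow> ok (st m) m) \<and> (\<forall>k \<in> A - C. Suc m \<le> k \<and> k < L \<longrightarrow> ok (st k) k)"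
    using step.hyps by (metis Suc_le_eq le_neq_implies_less order_refl less_imp_le)
  have upt: "[m..<L] = m # [Suc m..<L]" using step.hyps by (simp add: upt_rec)
  have st: "st (Suc m) = (if m \<in> C then step (st m) m else st m)" using assms(1) step.hyps by simp
  show ?case using step.IH assms(2) unfolding split upt st by (auto split: if_splits)
qed auto

section \<open>The cardinalities of the two sets as walk counts\<close>

context boundary_path begin

text \<open>This is the inverse of \<open>crossing_set\<close>. The conversion by \<open>nat\<close>
  loses nothing, since times in the strip are nonnegative.\<close>

definition filling_of :: "nat set \<Rightarrow> filling" where
  "filling_of C B =
     (if B \<in> strip P then Some (if nat (time B) \<in> C then Crossing else Elbow) else None)"

lemma periodic_filling_of: "periodic_filling P (filling_of C)"
proof -
  have "(a + W, b + K) \<in> strip P \<longleftrightarrow> (a, b) \<in> strip P" "time (a + W, b + K) = time (a, b)" for a b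
    using strip_translate[of a 1 b] time_translate[of a 1 b] by simp_all
  then show ?thesis
    by (auto simp: periodic_filling_def filling_of_def dom_def)
qed

lemma crossing_set_filling_of:
  assumes "C \<subseteq> active_times"
  shows "crossing_set (filling_of C) = C"
proof
  show "crossing_set (filling_of C) \<subseteq> C"
    by (auto simp: crossing_set_def filling_of_def split: if_splits)
  show "C \<subseteq> crossing_set (filling_of C)"
  proof
    fix m assume m: "m \<in> C"
    with assms obtain B where "B \<in> strip P" "time B = int m" by (auto simp: active_times_def)
    with m show "m \<in> crossing_set (filling_of C)"
      by (auto simp: crossing_set_def filling_of_def split_paired_Ex[symmetric]
          simp del: split_paired_Ex intro!: exI[of _ B])
  qed
qed

lemma filling_of_crossing_set:
  assumes "periodic_filling P D"
  shows "filling_of (crossing_set D) = D"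
proof
  interpret filled_strip P D using assms by unfold_locales
  fix B
  show "filling_of (crossing_set D) B = D B"
  proof (cases "B \<in> strip P")
    case True
    then obtain m where "time B = int m" by (rule time_nat)
    with True elbow_iff[of B m] crossing_times_iff[of B m] show ?thesis
      by (cases "m \<in> crossing_times") (simp_all add: filling_of_def)
  next
    case False
    then have "D B = None" using dom_D by blast
    with False show ?thesis by (simp add: filling_of_def)
  qed
qed

lemma bij_betw_crossing_set:
  "bij_betw crossing_set {D. periodic_filling P D \<and> \<Phi> (crossing_set D)} {C. C \<subseteq> active_times \<and> \<Phi> C}"
proof (rule bij_betw_byWitness[where f' = filling_of])
  have "crossing_set D \<subseteq> active_times" if "periodic_filling P D" for D
  proof -
    interpret filled_strip P D using that by unfold_locales
    show ?thesis by (rule crossing_times_subset)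
  qed
  then show "crossing_set ` {D. periodic_filling P D \<and> \<Phi> (crossing_set D)} \<subseteq>
      {C. C \<subseteq> active_times \<and> \<Phi> C}" by blast
qed (use filling_of_crossing_set crossing_set_filling_of periodic_filling_of in auto)

lemma Deo_eq:
  "Deo f P = {D. periodic_filling P D \<and> (let C = crossing_set D in label_pos C horizon = f \<and>
     (\<forall>m \<in> active_times - C.
       inv (label_pos C m) (int (m + 1)) < inv (label_pos C m) (int (m + 1) + 1)))}"
proof -
  have "has_strand_permutation P D f \<and> distinguished P D \<longleftrightarrow>
    (let C = crossing_set D in label_pos C horizon = f \<and>
     (\<forall>m \<in> active_times - C.
       inv (label_pos C m) (int (m + 1)) < inv (label_pos C m) (int (m + 1) + 1)))"
    if "periodic_filling P D" for D
  proof -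
    interpret filled_strip P D using that by unfold_locales
    show ?thesis by (simp only: has_strand_permutation_iff distinguished_iff Let_def)
  qed
  then show ?thesis unfolding Deo_def by blast
qed

text \<open>The final positions are replaced by the prescribed \<open>f\<close>, so the guard at
  time m depends on \<open>C\<close> only through the positions at m.\<close>

lemma anti_Deo_eq:
  "anti_Deo f P = {D. periodic_filling P D \<and> (let C = crossing_set D in label_pos C horizon = f \<and>
     (\<forall>m \<in> active_times - C.
       f (inv (label_pos C m) (int (m + 1))) < f (inv (label_pos C m) (int (m + 1) + 1))))}"
proof -
  have "has_strand_permutation P D f \<and> anti_distinguished P D \<longleftrightarrow>
    (let C = crossing_set D in label_pos C horizon = f \<and>
     (\<forall>m \<in> active_times - C.
       f (inv (label_pos C m) (int (m + 1))) < f (inv (label_pos C m) (int (m + 1) + 1))))"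
    if "periodic_filling P D" for D
  proof -
    interpret filled_strip P D using that by unfold_locales
    show ?thesis unfolding has_strand_permutation_iff anti_distinguished_iff Let_def by blast
  qed
  then show ?thesis unfolding anti_Deo_def by blast
qed

abbreviation letters :: "nat list" where
  "letters \<equiv> filter (\<lambda>m. m \<in> active_times) [0..<horizon]"

lemma set_letters: "set letters = active_times"
  using active_times_subset by auto

lemma card_Deo: "card (Deo f P) = dist_count (length P) (map Suc letters) (\<lambda>i. i + K) f"
proof -
  let ?step = "\<lambda>x m. sigma m \<circ> x"
  let ?ok = "\<lambda>x m. inv x (int (m + 1)) < inv x (int (m + 1) + 1)"
  let ?fin = "\<lambda>x. x = f"
  have walk: "walk ?step ?ok ?fin C letters (\<lambda>i. i + K) \<longleftrightarrow>
      (label_pos C horizon = f \<and> (\<forall>m \<in> active_times - C. ?ok (label_pos C m) m))"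
    if "C \<subseteq> active_times" for C
    using walk_trajectory[of horizon "label_pos C" C ?step active_times 0 ?ok ?fin, OF _ that]
      active_times_subset by auto
  have "card (Deo f P) = card {C. C \<subseteq> active_times \<and>
      label_pos C horizon = f \<and> (\<forall>m \<in> active_times - C. ?ok (label_pos C m) m)}"
    unfolding Deo_eq Let_def by (rule bij_betw_same_card[OF bij_betw_crossing_set])
  also have "\<dots> = card {C. C \<subseteq> set letters \<and> walk ?step ?ok ?fin C letters (\<lambda>i. i + K)}"
    unfolding set_letters using walk by (intro arg_cong[where f = card]) blast
  also have "\<dots> = walk_count ?step ?ok ?fin letters (\<lambda>i. i + K)"
    by (rule card_walks) simp
  also have "walk_count ?step ?ok ?fin ms x = dist_count (length P) (map Suc ms) x f" for ms x
    by (induction ms arbitrary: x) simp_all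
  finally show ?thesis .
qed

text \<open>The state \<open>?y C m\<close> sends positions at time m to exits. It starts at the
  shifted \<open>f\<close>, each crossing multiplies it on the right, and it ends at the identity
  exactly if the strand permutation is \<open>f\<close>.\<close>

lemma card_anti_Deo: "card (anti_Deo f P) = anti_count (length P) (map Suc letters) (f \<circ> (\<lambda>i. i - K))"
proof -
  let ?step = "\<lambda>y m. y \<circ> sigma m"
  let ?ok = "\<lambda>y m. y (int (m + 1)) < y (int (m + 1) + 1)"
  let ?fin = "\<lambda>y. y = (id :: int \<Rightarrow> int)"
  let ?y = "\<lambda>C m. f \<circ> inv (label_pos C m)"
  have bij: "bij (label_pos C m)" for C m
    using affine_permutation_label_pos by (simp add: affine_permutation_def)
  have y0: "?y C 0 = f \<circ> (\<lambda>i. i - K)" for C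
    using inv_equality[of "\<lambda>i. i - K" "\<lambda>i. i + K"] by simp
  have ySuc: "?y C (Suc m) = (if m \<in> C then ?step (?y C m) m else ?y C m)" for C m
  proof -
    have "inv (sigma m \<circ> label_pos C m) = inv (label_pos C m) \<circ> sigma m"
      using bij affine_permutation_simple_transposition[OF length_ge_2]
      by (simp add: o_inv_distrib affine_permutation_def inv_simple_transposition[OF length_ge_2])
    then show ?thesis by (simp add: comp_assoc)
  qed
  have fin: "?y C m = id \<longleftrightarrow> label_pos C m = f" for C m
    using bij_is_surj[OF bij, of C m] bij_is_inj[OF bij, of C m]
    by (metis comp_assoc comp_id id_comp inv_o_cancel surj_iff)
  have walk: "walk ?step ?ok ?fin C letters (f \<circ> (\<lambda>i. i - K)) \<longleftrightarrow>
      (label_pos C horizon = f \<and> (\<forall>m \<in> active_times - C. ?ok (?y C m) m))"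
    if "C \<subseteq> active_times" for C
    using walk_trajectory[of horizon "?y C" C ?step active_times 0 ?ok ?fin, OF ySuc that]
      active_times_subset unfolding y0 fin by auto
  have "card (anti_Deo f P) = card {C. C \<subseteq> active_times \<and>
      label_pos C horizon = f \<and> (\<forall>m \<in> active_times - C. ?ok (?y C m) m)}"
    unfolding anti_Deo_eq Let_def o_apply by (rule bij_betw_same_card[OF bij_betw_crossing_set])
  also have "\<dots> = card {C. C \<subseteq> set letters \<and> walk ?step ?ok ?fin C letters (f \<circ> (\<lambda>i. i - K))}"
    unfolding set_letters using walk by (intro arg_cong[where f = card]) blast
  also have "\<dots> = walk_count ?step ?ok ?fin letters (f \<circ> (\<lambda>i. i - K))"
    by (rule card_walks) simp
  also have "walk_count ?step ?ok ?fin ms y = anti_count (length P) (map Suc ms) y" for ms y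
    by (induction ms arbitrary: y) simp_all
  finally show ?thesis .
qed

lemma finite_fillings: "finite {D. periodic_filling P D}"
proof -
  have "finite active_times" using active_times_subset finite_subset by blast
  then have "finite {C. C \<subseteq> active_times \<and> True}" by simp
  then show ?thesis
    using bij_betw_finite[OF bij_betw_crossing_set[of "\<lambda>_. True"]] by simp
qed

lemma card_anti_Deo_eq_card_Deo: "card (anti_Deo f P) = card (Deo f P)"
proof -
  have "affine_permutation (length P) id" by (simp add: affine_permutation_def)
  then have "dist_count (length P) qs (\<lambda>i. i + K) f = dist_count (length P) qs id (f \<circ> (\<lambda>i. i - K))"
    for qs using dist_count_shift[OF length_ge_2, of id qs K f] unfolding id_comp by blast
  then show ?thesis
    unfolding card_Deo card_anti_Deo using dist_count_id_eq_anti_count[OF length_ge_2] by simp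
qed

end

section \<open>Paths without boxes, and the conclusion\<close>

lemma strip_empty:
  assumes "P \<noteq> []" "Right \<notin> set P \<or> Up \<notin> set P"
  shows "strip P = {}"
proof (cases "Up \<in> set P")
  case True
  then have "Right \<notin> set P" using assms by blast
  moreover have "ext_step P i \<in> set P" for i
    using assms(1) by (auto simp: ext_step_def nat_less_iff intro!: nth_mem)
  ultimately have "ext_step P i = Up" for i by (metis step.exhaust)
  then show ?thesis by (auto simp: strip_def south_edge_def edge_of_step_def)
next
  case False
  then have "height P = 0" by (simp add: height_def)
  then show ?thesis by (auto simp: strip_def)
qed

theorem theorem1p3:
  fixes n k :: nat and f :: "int \<Rightarrow> int" and P :: "step list" and w :: "nat list"
  assumes "1 \<le> n" and "k \<le> n"
    and "f \<in> bounded_affine_perms k n"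
    and "P \<in> lattice_paths k n"
    and "reduced_word_for k n f w"
  shows "\<exists>\<phi>. bij_betw \<phi> (anti_Deo f P) (Deo f P)"
proof (cases "Right \<in> set P \<and> Up \<in> set P")
  case True
  then interpret boundary_path P by unfold_locales simp_all
  \<comment> \<open>Infinite sets have \<open>card\<close> 0, so equal cardinalities give a
    bijection only together with finiteness.\<close>
  have "finite (anti_Deo f P)" "finite (Deo f P)"
    by (rule finite_subset[OF _ finite_fillings]; auto simp: anti_Deo_def Deo_def)+
  then show ?thesis using card_anti_Deo_eq_card_Deo by (rule finite_same_card_bij)
next
  case False
  have "P \<noteq> []" using assms(1,4) by (auto simp: lattice_paths_def)
  with False have "strip P = {}" by (intro strip_empty) auto
  \<comment> \<open>Without boxes there are no elbows, so both conditions are vacuous and the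
    identity is the bijection.\<close>
  then have "distinguished P D \<and> anti_distinguished P D" if "periodic_filling P D" for D
    using that by (auto simp: periodic_filling_def distinguished_def anti_distinguished_def)
  then have "anti_Deo f P = Deo f P" by (auto simp: anti_Deo_def Deo_def)
  then show ?thesis using bij_betw_id by metis
qed

end
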